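(* Let $\mathcal{E}_f:\ y''=f(x,y,y')$ be a second order ordinary differential equation with $f$ analytic. Then $\mathcal{E}_f$ is equivalent to the first Painlevé equation $\bar y''=6\bar y^2+\bar x$ by a fiber-preserving transformation $(x,y)\mapsto(\bar x,\bar y)$ if and only if this transformation, together with its first prolongation $\bar p=\frac{d\bar y}{d\bar x}$, is given by $$\bar p = 129600\,\frac{5\,I_{1;33}^2+4\,I_{1;33333}}{I_{1;33}^3}\,\bar y^4,$$ $$\bar x = -6\,\frac{120\,I_{1;3333}+43\,I_{1;33}^2}{I_{1;33}^2}\,\bar y^2,$$ $$\bar y^5 = -\frac{1}{23328000}\,\frac{I_{1;33}^5}{\left(5\,I_{1;33}^2+4\,I_{1;33333}\right)^2},$$ where $I_{1;33}, I_{1;3333}, I_{1;33333}$ are the differential invariants of $f$ defined in the context, evaluated at the values of the parameters $a_1,a_2,a_4$ determined by the normalization $$I_1=-12,\qquad I_{1;3}=0,\qquad \frac{I_{1;333}}{I_{1;33}}=1 .$$ That is: every fiber-preserving transformation mapping $\mathcal{E}_f$ to the first Painlevé equation satisfies these formulas, and $\mathcal{E}_f$ is equivalent to the first Painlevé equation exactly when these formulas (for a local branch of $\bar y$) define a fiber-preserving transformation which maps $\mathcal{E}_f$ to the first Painlevé equation.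
   Context: Everything is complex analytic and local (at generic points, where the expressions involved are defined). A fiber-preserving transformation is a locally invertible analytic transformation $(x,y)\mapsto(\bar x(x),\bar y(x,y))$ of $\mathbb{C}^2$, i.e. $\bar x_y=0$ and $\bar x_x\bar y_y\neq 0$. The coordinates on the first jet space $J^1=J^1(\mathbb{C},\mathbb{C})$ are $(x,y,p)$ with $p=y'$. Two equations $\mathcal{E}_f: y''=f(x,y,y')$ and $\mathcal{E}_{\bar f}:\bar y''=\bar f(\bar x,\bar y,\bar y')$ are equivalent under a fiber-preserving transformation $\varphi$ (also: $\varphi$ maps $\mathcal{E}_f$ to $\mathcal{E}_{\bar f}$) if the first prolongation of $\varphi$ satisfies $$\varphi^*\begin{pmatrix} d\bar y-\bar p\,d\bar x \\ d\bar p-\bar f\,d\bar x \\ d\bar x \end{pmatrix}=\begin{pmatrix} a_1 & 0 & 0 \\ a_2 & a_3 & 0 \\ 0 & 0 & a_4 \end{pmatrix}\begin{pmatrix} dy-p\,dx \\ dp-f\,dx \\ dx \end{pmatrix}$$ for some functions $a_i:J^1\to\mathbb{C}$ with the matrix invertible. Let $\tilde M$ be the manifold fibred over $J^1$ with local coordinates $(x,y,p,a_1,a_2,a_4)$. Subscripts $x,y,p$ denote partial derivatives, $f=f(x,y,p)$, and $D_x=\partial_x+p\,\partial_y+f\,\partial_p$. Define on $\tilde M$ $$I_{1}= \frac{(2 f_{yy} - D_{x}f_{yp} - f_{pp} f_{y} + f_{yp} f_{p})\, a_{1} + ( - f_{yp} + D_{x}f_{pp})\, a_{4} a_{2}}{2a_{1}^{2}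 a_{4}^{2}},$$ $$I_{2}= \frac{f_{yp} - D_{x}f_{pp}}{2a_{1} a_{4}},\qquad I_3=-\frac{f_{ppp}\,a_4}{2a_1^2}.$$ These are the fundamental invariants of the fiber-preserving equivalence problem. On the Painlevé equations $I_2=I_3=0$, and on the branch $I_2=I_3=0$ the following vector field on $\tilde M$ is an invariant derivation: $$X_3=\frac{1}{a_{4}}\partial_x + \frac{p}{a_{4}}\partial_y + \frac{f}{a_{4}}\partial_p + a_{2}\,\partial_{a_{1}} - \frac{f_{y} a_{1}}{a_{4}^{2}}\,\partial_{a_{2}} + \frac{2 a_{2} a_{4} + f_{p} a_{1}}{a_{1}}\,\partial_{a_{4}}.$$ Notation: $I_{1;3\cdots3}$ with $k$ threes is $X_3^k(I_1)$. To evaluate with the normalization means: first compute these functions on $\tilde M$, then solve the three normalization equations for $a_1,a_2,a_4$ as functions of $(x,y,p)$ and substitute, obtaining functions of $(x,y,p)$ only. *)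

theory Defs
  imports "HOL-Complex_Analysis.Complex_Analysis"
begin

text \<open>Local expansion into a convergent power series.\<close>

definition analytic2_on :: "(complex \<Rightarrow> complex \<Rightarrow> complex) \<Rightarrow> (complex \<times> complex) set \<Rightarrow> bool" where
  "analytic2_on g S \<longleftrightarrow>
     (\<forall>(x0, y0) \<in> S. \<exists>r>0. \<exists>c :: nat \<Rightarrow> nat \<Rightarrow> complex.
        \<forall>x\<in>ball x0 r. \<forall>y\<in>ball y0 r.
          ((\<lambda>(i, j). c i j * (x - x0) ^ i * (y - y0) ^ j) has_sum g x y) UNIV)"

definition analytic3_on ::
    "(complex \<Rightarrow> complex \<Rightarrow> complex \<Rightarrow> complex) \<Rightarrow> (complex \<times> complex \<times> complex) set \<Rightarrow> bool" where
  "analytic3_on g S \<longleftrightarrow>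
     (\<forall>(x0, y0, p0) \<in> S. \<exists>r>0. \<exists>c :: nat \<Rightarrow> nat \<Rightarrow> nat \<Rightarrow> complex.
        \<forall>x\<in>ball x0 r. \<forall>y\<in>ball y0 r. \<forall>p\<in>ball p0 r.
          ((\<lambda>(i, j, k). c i j k * (x - x0) ^ i * (y - y0) ^ j * (p - p0) ^ k)
             has_sum g x y p) UNIV)"

text \<open>Functions of the jet coordinates \<open>(x, y, p)\<close>, where \<open>p = y'\<close>.\<close>

type_synonym jet_fun = "complex \<Rightarrow> complex \<Rightarrow> complex \<Rightarrow> complex"

definition pd_x :: "jet_fun \<Rightarrow> jet_fun" where
  "pd_x g = (\<lambda>x y p. deriv (\<lambda>t. g t y p) x)"

definition pd_y :: "jet_fun \<Rightarrow> jet_fun" where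
  "pd_y g = (\<lambda>x y p. deriv (\<lambda>t. g x t p) y)"

definition pd_p :: "jet_fun \<Rightarrow> jet_fun" where
  "pd_p g = (\<lambda>x y p. deriv (\<lambda>t. g x y t) p)"

definition total_D :: "jet_fun \<Rightarrow> jet_fun \<Rightarrow> jet_fun" where
  "total_D f g = (\<lambda>x y p. pd_x g x y p + p * pd_y g x y p + f x y p * pd_p g x y p)"

definition base :: "(complex \<times> complex \<times> complex) set \<Rightarrow> (complex \<times> complex) set" where
  "base W = (\<lambda>(x, y, p). (x, y)) ` W"

text \<open>The transformation \<open>(x, y) \<mapsto> (X x, Y x y)\<close>.\<close>

definition fiber_preserving_on ::
    "(complex \<times> complex) set \<Rightarrow> (complex \<Rightarrow> complex) \<Rightarrow> (complex \<Rightarrow> complex \<Rightarrow> complex) \<Rightarrow> bool" where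
  "fiber_preserving_on V X Y \<longleftrightarrow>
     X analytic_on (fst ` V) \<and> analytic2_on Y V \<and>
     (\<forall>(x, y) \<in> V. deriv X x \<noteq> 0 \<and> deriv (\<lambda>t. Y x t) y \<noteq> 0)"

text \<open>The component \<open>d\<bar>y / d\<bar>x\<close> of the first prolongation.\<close>

definition prolong :: "(complex \<Rightarrow> complex) \<Rightarrow> (complex \<Rightarrow> complex \<Rightarrow> complex) \<Rightarrow> jet_fun" where
  "prolong X Y = (\<lambda>x y p. (deriv (\<lambda>t. Y t y) x + p * deriv (\<lambda>t. Y x t) y) / deriv X x)"

text \<open>A 1-form on the jet space is represented by the row of its coefficients with respect to
  \<open>dx, dy, dp\<close>.  The rows of the coframe are \<open>dy - p dx\<close>, \<open>dp - f dx\<close>, \<open>dx\<close>.  The pullback of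
  forms along a map is multiplication of the rows, taken at the image point, by the Jacobian
  matrix of the map.\<close>

definition coframe :: "jet_fun \<Rightarrow> complex \<Rightarrow> complex \<Rightarrow> complex \<Rightarrow> complex ^ 3 ^ 3" where
  "coframe f x y p = vector
     [vector [- p, 1, 0],
      vector [- f x y p, 0, 1],
      vector [1, 0, 0]]"

definition jacobian3 ::
    "jet_fun \<Rightarrow> jet_fun \<Rightarrow> jet_fun \<Rightarrow> complex \<Rightarrow> complex \<Rightarrow> complex \<Rightarrow> complex ^ 3 ^ 3" where
  "jacobian3 A B C x y p = vector
     [vector [pd_x A x y p, pd_y A x y p, pd_p A x y p],
      vector [pd_x B x y p, pd_y B x y p, pd_p B x y p],
      vector [pd_x C x y p, pd_y C x y p, pd_p C x y p]]"

definition pullback_coframe ::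
    "(complex \<Rightarrow> complex) \<Rightarrow> (complex \<Rightarrow> complex \<Rightarrow> complex) \<Rightarrow> jet_fun \<Rightarrow>
     complex \<Rightarrow> complex \<Rightarrow> complex \<Rightarrow> complex ^ 3 ^ 3" where
  "pullback_coframe X Y F x y p =
     coframe F (X x) (Y x y) (prolong X Y x y p) **
     jacobian3 (\<lambda>x y p. X x) (\<lambda>x y p. Y x y) (prolong X Y) x y p"

definition structure_matrix :: "complex \<Rightarrow> complex \<Rightarrow> complex \<Rightarrow> complex \<Rightarrow> complex ^ 3 ^ 3" where
  "structure_matrix a1 a2 a3 a4 = vector
     [vector [a1, 0, 0],
      vector [a2, a3, 0],
      vector [0, 0, a4]]"

text \<open>\<open>(X, Y)\<close> is a fiber-preserving transformation which maps \<open>y'' = f(x, y, y')\<close> to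
  \<open>y'' = F(x, y, y')\<close> over the region \<open>W\<close> of the jet space.\<close>

definition maps_ode_on ::
    "(complex \<times> complex \<times> complex) set \<Rightarrow> jet_fun \<Rightarrow> jet_fun \<Rightarrow>
     (complex \<Rightarrow> complex) \<Rightarrow> (complex \<Rightarrow> complex \<Rightarrow> complex) \<Rightarrow> bool" where
  "maps_ode_on W f F X Y \<longleftrightarrow>
     fiber_preserving_on (base W) X Y \<and>
     (\<exists>(a1::jet_fun) (a2::jet_fun) (a3::jet_fun) (a4::jet_fun). \<forall>(x, y, p) \<in> W.
        let M = structure_matrix (a1 x y p) (a2 x y p) (a3 x y p) (a4 x y p)
        in invertible M \<and> pullback_coframe X Y F x y p = M ** coframe f x y p)"

definition equivalent_ode ::
    "(complex \<times> complex \<times> complex) set \<Rightarrow> jet_fun \<Rightarrow> jet_fun \<Rightarrow> bool" where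
  "equivalent_ode U f F \<longleftrightarrow>
     (\<exists>W X Y. open W \<and> W \<noteq> {} \<and> W \<subseteq> U \<and> maps_ode_on W f F X Y)"

definition painleve1 :: jet_fun where
  "painleve1 = (\<lambda>x y p. 6 * y\<^sup>2 + x)"

text \<open>Functions of the coordinates \<open>(x, y, p, a\<^sub>1, a\<^sub>2, a\<^sub>4)\<close>.\<close>

type_synonym lifted_fun =
  "complex \<Rightarrow> complex \<Rightarrow> complex \<Rightarrow> complex \<Rightarrow> complex \<Rightarrow> complex \<Rightarrow> complex"

definition inv_I1 :: "jet_fun \<Rightarrow> lifted_fun" where
  "inv_I1 f = (\<lambda>x y p a1 a2 a4.
     ((2 * pd_y (pd_y f) x y p - total_D f (pd_p (pd_y f)) x y p
         - pd_p (pd_p f) x y p * pd_y f x y p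
         + pd_p (pd_y f) x y p * pd_p f x y p) * a1
      + (- pd_p (pd_y f) x y p + total_D f (pd_p (pd_p f)) x y p) * a4 * a2)
     / (2 * a1\<^sup>2 * a4\<^sup>2))"

definition X3 :: "jet_fun \<Rightarrow> lifted_fun \<Rightarrow> lifted_fun" where
  "X3 f H = (\<lambda>x y p a1 a2 a4.
       1 / a4 * deriv (\<lambda>t. H t y p a1 a2 a4) x
     + p / a4 * deriv (\<lambda>t. H x t p a1 a2 a4) y
     + f x y p / a4 * deriv (\<lambda>t. H x y t a1 a2 a4) p
     + a2 * deriv (\<lambda>t. H x y p t a2 a4) a1
     - pd_y f x y p * a1 / a4\<^sup>2 * deriv (\<lambda>t. H x y p a1 t a4) a2
     + (2 * a2 * a4 + pd_p f x y p * a1) / a1 * deriv (\<lambda>t. H x y p a1 a2 t) a4)"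

text \<open>\<open>inv_I1_3 f k\<close> is \<open>I\<close> with index \<open>1;3\<dots>3\<close> (\<open>k\<close> threes).\<close>

definition inv_I1_3 :: "jet_fun \<Rightarrow> nat \<Rightarrow> lifted_fun" where
  "inv_I1_3 f k = (X3 f ^^ k) (inv_I1 f)"

text \<open>Since \<open>u / 0 = 0\<close>, the last equation below already forces its denominator to be nonzero.\<close>

definition normalization ::
    "jet_fun \<Rightarrow> complex \<Rightarrow> complex \<Rightarrow> complex \<Rightarrow> complex \<times> complex \<times> complex \<Rightarrow> bool" where
  "normalization f x y p = (\<lambda>(a1, a2, a4).
     a1 \<noteq> 0 \<and> a4 \<noteq> 0 \<and>
     inv_I1 f x y p a1 a2 a4 = - 12 \<and>
     inv_I1_3 f 1 x y p a1 a2 a4 = 0 \<and>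
     inv_I1_3 f 3 x y p a1 a2 a4 / inv_I1_3 f 2 x y p a1 a2 a4 = 1)"

definition normalized_params ::
    "jet_fun \<Rightarrow> complex \<Rightarrow> complex \<Rightarrow> complex \<Rightarrow> complex \<times> complex \<times> complex" where
  "normalized_params f x y p = (THE a. normalization f x y p a)"

definition normalized_inv :: "jet_fun \<Rightarrow> nat \<Rightarrow> jet_fun" where
  "normalized_inv f k = (\<lambda>x y p.
     case normalized_params f x y p of (a1, a2, a4) \<Rightarrow> inv_I1_3 f k x y p a1 a2 a4)"

text \<open>The points where all the expressions in the formulas are defined: the normalization
  determines the parameters, and the denominators do not vanish.\<close>

definition generic_point :: "jet_fun \<Rightarrow> complex \<Rightarrow> complex \<Rightarrow> complex \<Rightarrow> bool" where
  "generic_point f x y p \<longleftrightarrow>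
     (\<exists>!a. normalization f x y p a) \<and>
     normalized_inv f 2 x y p \<noteq> 0 \<and>
     5 * (normalized_inv f 2 x y p)\<^sup>2 + 4 * normalized_inv f 5 x y p \<noteq> 0"

definition painleve1_formulas ::
    "jet_fun \<Rightarrow> (complex \<Rightarrow> complex) \<Rightarrow> (complex \<Rightarrow> complex \<Rightarrow> complex) \<Rightarrow>
     complex \<Rightarrow> complex \<Rightarrow> complex \<Rightarrow> bool" where
  "painleve1_formulas f X Y x y p \<longleftrightarrow>
     (let I33 = normalized_inv f 2 x y p;
          I3333 = normalized_inv f 4 x y p;
          I33333 = normalized_inv f 5 x y p
      in prolong X Y x y p = 129600 * ((5 * I33\<^sup>2 + 4 * I33333) / I33 ^ 3) * (Y x y) ^ 4 \<and>
         X x = - 6 * ((120 * I3333 + 43 * I33\<^sup>2) / I33\<^sup>2) * (Y x y)\<^sup>2 \<and>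
         (Y x y) ^ 5 = - (1 / 23328000) * (I33 ^ 5 / (5 * I33\<^sup>2 + 4 * I33333)\<^sup>2))"

end

theory Submission
  imports Defs
begin

text \<open>
  Suppose that \<open>(X, Y)\<close> maps \<open>y'' = f\<close> to the first Painleve equation, and let \<open>P\<close> be the
  prolongation, so that \<open>D P = X' (6 Y\<^sup>2 + X)\<close>.  This equation is linear in \<open>f\<close> and determines it.
  The differential consequences needed below are governed by the single function
  \<open>Q = Y_xy / Y_y + p Y_yy / Y_y\<close>, which is \<open>D (ln Y_y)\<close>:
  \<open>f_p = X'' / X' - 2 Q\<close> and \<open>f_y = 12 Y X'\<^sup>2 - D Q - Q\<^sup>2 + Q X'' / X'\<close>.
  Since mixed partial derivatives of \<open>ln Y_y\<close> commute, they give \<open>f_yp = D f_pp\<close> and collapse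
  the numerator of \<open>I\<^sub>1\<close> to \<open>24 X'\<^sup>2 Y_y a\<^sub>1\<close>.

  Under the lifted transformation, the functions \<open>1 / a\<^sub>1\<close>, \<open>1 / a\<^sub>4\<close> and \<open>a\<^sub>2 / a\<^sub>1\<close> of the target
  pull back to \<open>u = Y_y / a\<^sub>1\<close>, \<open>v = X' / a\<^sub>4\<close> and \<open>w = a\<^sub>2 / a\<^sub>1 - Q / a\<^sub>4\<close>.  The lifted transformation carries one invariant
  derivation to the other, and here this means that \<open>X\<^sub>3\<close> acts on the six functions
  \<open>X, Y, P, u, v, w\<close> by a closed polynomial system:
    \<open>X \<mapsto> v\<close>, \<open>Y \<mapsto> v P\<close>, \<open>P \<mapsto> v (6 Y\<^sup>2 + X)\<close>,
    \<open>u \<mapsto> - w u\<close>, \<open>v \<mapsto> - 2 w v\<close>, \<open>w \<mapsto> - 12 Y v\<^sup>2 - w\<^sup>2\<close>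
  (lemmas \<open>X3_X\<close> to \<open>X3_w\<close>).  Starting from \<open>I\<^sub>1 = 12 u v\<^sup>2\<close> (\<open>inv_I1_eq\<close>), all the iterated
  derivatives are therefore explicit polynomials in these six functions (\<open>inv_I1_3_eqs\<close>).

  The normalization reads \<open>u v\<^sup>2 = - 1\<close>, \<open>w = 0\<close> and \<open>v P = Y\<close> with \<open>Y \<noteq> 0\<close>
  (\<open>normalization_iff\<close>).  It has a solution, and then only one, exactly where \<open>Y\<close> and \<open>P\<close>
  do not vanish.  Substituting it turns the polynomials into
    \<open>I\<^sub>1\<^sub>;\<^sub>3\<^sub>3 = - 720 Y v\<^sup>2\<close>, \<open>I\<^sub>1\<^sub>;\<^sub>3\<^sub>3\<^sub>3\<^sub>3 = - 720 (258 Y\<^sup>2 + X) v\<^sup>4\<close> and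
    \<open>5 I\<^sub>1\<^sub>;\<^sub>3\<^sub>3\<^sup>2 + 4 I\<^sub>1\<^sub>;\<^sub>3\<^sub>3\<^sub>3\<^sub>3\<^sub>3 = - 2880 v\<^sup>5\<close> with \<open>v = Y / P\<close>,
  and solving for \<open>P\<close>, \<open>X\<close> and \<open>Y\<^sup>5\<close> is the assertion.  The exceptional points are nowhere dense
  because \<open>Y_y\<close> and \<open>P_p = Y_y / X'\<close> vanish nowhere; removing them from the region of an
  arbitrary equivalence leaves an equivalence for which the formulas hold everywhere.
\<close>

section \<open>Convergent double power series\<close>

definition dx :: "(complex \<Rightarrow> complex \<Rightarrow> complex) \<Rightarrow> complex \<Rightarrow> complex \<Rightarrow> complex" where
  "dx g = (\<lambda>x y. deriv (\<lambda>t. g t y) x)"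

definition dy :: "(complex \<Rightarrow> complex \<Rightarrow> complex) \<Rightarrow> complex \<Rightarrow> complex \<Rightarrow> complex" where
  "dy g = (\<lambda>x y. deriv (\<lambda>t. g x t) y)"

definition double_series ::
    "(nat \<Rightarrow> nat \<Rightarrow> complex) \<Rightarrow> complex \<Rightarrow> complex \<Rightarrow> real \<Rightarrow>
     (complex \<Rightarrow> complex \<Rightarrow> complex) \<Rightarrow> bool" where
  "double_series c x0 y0 r g \<longleftrightarrow>
     (\<forall>x\<in>ball x0 r. \<forall>y\<in>ball y0 r.
        ((\<lambda>(i, j). c i j * (x - x0) ^ i * (y - y0) ^ j) has_sum g x y) UNIV)"

lemma analytic2_on_iff_double_series:
  "analytic2_on g S \<longleftrightarrow> (\<forall>(x0, y0)\<in>S. \<exists>r>0. \<exists>c. double_series c x0 y0 r g)"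
  by (simp add: analytic2_on_def double_series_def)

lemma double_series_swap:
  assumes "double_series c x0 y0 r g"
  shows "double_series (\<lambda>i j. c j i) y0 x0 r (\<lambda>y x. g x y)"
  unfolding double_series_def
proof (intro ballI)
  fix y x assume "y \<in> ball y0 r" "x \<in> ball x0 r"
  then have "((\<lambda>(i, j). c i j * (x - x0) ^ i * (y - y0) ^ j) has_sum g x y) UNIV"
    using assms unfolding double_series_def by blast
  then have "((\<lambda>q. (\<lambda>(i, j). c i j * (x - x0) ^ i * (y - y0) ^ j) (prod.swap q)) has_sum g x y) UNIV"
    by (subst has_sum_reindex_bij_betw[of prod.swap UNIV UNIV]) auto
  then show "((\<lambda>(i, j). c j i * (y - y0) ^ i * (x - x0) ^ j) has_sum g x y) UNIV"
    by (rule has_sum_cong[THEN iffD1, rotated]) (auto simp: prod.swap_def)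
qed

text \<open>A multiple series in \<open>\<complex>\<close> converges unconditionally only if it converges absolutely, so evaluating
  at real offsets bounds the series on closed bidiscs; this is the majorant for both uniform
  convergence arguments below.\<close>

lemma double_series_dominated:
  assumes S: "double_series c x0 y0 r g" and "0 \<le> a" "a < r" "0 \<le> b" "b < r"
  shows "(\<lambda>(i, j). norm (c i j) * a ^ i * b ^ j) summable_on UNIV"
proof -
  have "x0 + of_real a \<in> ball x0 r" "y0 + of_real b \<in> ball y0 r"
    using assms(2-) by (auto simp: dist_norm)
  then have "((\<lambda>(i, j). c i j * (x0 + of_real a - x0) ^ i * (y0 + of_real b - y0) ^ j)
          has_sum g (x0 + of_real a) (y0 + of_real b)) UNIV"
    using S unfolding double_series_def by blast
  then have "(\<lambda>(i, j). c i j * of_real a ^ i * of_real b ^ j) summable_on UNIV"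
    by (simp add: has_sum_imp_summable)
  then have "(\<lambda>q. norm ((\<lambda>(i, j). c i j * of_real a ^ i * of_real b ^ j) q)) summable_on UNIV"
    by (simp only: summable_on_iff_abs_summable_on_complex)
  then show ?thesis
    using assms(2-) by (simp add: case_prod_unfold norm_mult norm_power)
qed

lemma double_series_continuous_at_center:
  assumes S: "double_series c x0 y0 r g" and "r > 0"
  shows "isCont (\<lambda>(x, y). g x y) (x0, y0)"
proof -
  define B where "B = cball x0 (r/2) \<times> cball y0 (r/2)"
  have ul: "uniform_limit B (\<lambda>X z. \<Sum>q\<in>X. c (fst q) (snd q) * (fst z - x0) ^ fst q * (snd z - y0) ^ snd q)
        (\<lambda>z. g (fst z) (snd z)) (finite_subsets_at_top UNIV)"
  proof (rule Weierstrass_m_test_general')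
    fix q :: "nat \<times> nat" and z assume "z \<in> B"
    then have "norm (fst z - x0) \<le> r/2" "norm (snd z - y0) \<le> r/2"
      by (auto simp: B_def dist_norm norm_minus_commute)
    then show "norm (c (fst q) (snd q) * (fst z - x0) ^ fst q * (snd z - y0) ^ snd q)
        \<le> (\<lambda>(i, j). norm (c i j) * (r/2) ^ i * (r/2) ^ j) q"
      using \<open>r > 0\<close>
      by (auto simp: case_prod_unfold norm_mult norm_power intro!: mult_mono power_mono)
  next
    fix z assume "z \<in> B"
    then have "fst z \<in> ball x0 r" "snd z \<in> ball y0 r"
      using \<open>r > 0\<close> by (auto simp: B_def)
    then show "((\<lambda>q. c (fst q) (snd q) * (fst z - x0) ^ fst q * (snd z - y0) ^ snd q) has_sum g (fst z) (snd z)) UNIV"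
      using S by (auto simp: double_series_def case_prod_unfold)
  next
    show "(\<lambda>(i, j). norm (c i j) * (r/2) ^ i * (r/2) ^ j) summable_on UNIV"
      using double_series_dominated[OF S, of "r/2" "r/2"] \<open>r > 0\<close> by simp
  qed
  have "continuous_on B (\<lambda>z. g (fst z) (snd z))"
    by (rule uniform_limit_theorem[OF _ ul])
       (auto intro!: always_eventually continuous_intros)
  moreover have "(x0, y0) \<in> interior B"
    using \<open>r > 0\<close> by (auto simp: B_def interior_Times)
  ultimately show ?thesis
    using continuous_on_interior by (fastforce simp: case_prod_unfold)
qed

text \<open>The finite partial sums are polynomials in the first variable and converge uniformly on a disc
  that contains \<open>x\<close> in its interior.  For uniform limits of holomorphic functions the derivatives
  converge along the same filter, here that of all finite subsets of the index set.  This is the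
  termwise differentiated series at once, with no estimate of its coefficients.\<close>

lemma double_series_dx:
  assumes S: "double_series c x0 y0 r g" and x: "x \<in> ball x0 r" and y: "y \<in> ball y0 r"
  shows "((\<lambda>t. g t y) has_field_derivative dx g x y) (at x)"
    and "((\<lambda>(i, j). of_nat (Suc i) * c (Suc i) j * (x - x0) ^ i * (y - y0) ^ j) has_sum dx g x y) UNIV"
proof -
  \<comment> \<open>any radius strictly between the distance to \<open>x\<close> and \<open>r\<close>\<close>
  define \<rho> where "\<rho> = (dist x0 x + r) / 2"
  have \<rho>: "dist x0 x < \<rho>" "\<rho> < r" "0 \<le> \<rho>"
    using x by (auto simp: \<rho>_def) (smt (verit) zero_le_dist)
  define T where "T = (\<lambda>q t. c (fst q) (snd q) * (t - x0) ^ fst q * (y - y0) ^ snd q)"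
  define T' where "T' = (\<lambda>q t. c (fst q) (snd q) * (of_nat (fst q) * (t - x0) ^ (fst q - 1)) * (y - y0) ^ snd q)"
  have ul: "uniform_limit (cball x0 \<rho>) (\<lambda>X t. \<Sum>q\<in>X. T q t) (\<lambda>t. g t y) (finite_subsets_at_top UNIV)"
  proof (rule Weierstrass_m_test_general')
    fix q :: "nat \<times> nat" and t assume "t \<in> cball x0 \<rho>"
    then show "norm (T q t) \<le> (\<lambda>(i, j). norm (c i j) * \<rho> ^ i * norm (y - y0) ^ j) q"
      using \<rho>
      by (auto simp: T_def case_prod_unfold norm_mult norm_power dist_norm norm_minus_commute
          intro!: mult_mono power_mono)
  next
    fix t assume "t \<in> cball x0 \<rho>"
    then show "((\<lambda>q. T q t) has_sum g t y) UNIV"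
      using S \<rho> y by (auto simp: T_def double_series_def case_prod_unfold)
  next
    show "(\<lambda>(i, j). norm (c i j) * \<rho> ^ i * norm (y - y0) ^ j) summable_on UNIV"
      using double_series_dominated[OF S, of \<rho> "norm (y - y0)"] \<rho> y
      by (simp add: dist_norm norm_minus_commute)
  qed
  have "\<forall>\<^sub>F X in finite_subsets_at_top UNIV. continuous_on (cball x0 \<rho>) (\<lambda>t. \<Sum>q\<in>X. T q t) \<and>
      (\<forall>w\<in>ball x0 \<rho>. ((\<lambda>t. \<Sum>q\<in>X. T q t) has_field_derivative (\<Sum>q\<in>X. T' q w)) (at w))"
    unfolding T_def T'_def
    by (rule always_eventually)
       (auto intro!: continuous_intros derivative_eq_intros sum.cong simp: mult_ac)
  from has_complex_derivative_uniform_limit[OF this ul]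
  obtain g' where g': "\<And>w. w \<in> ball x0 \<rho> \<Longrightarrow>
      ((\<lambda>t. g t y) has_field_derivative g' w) (at w) \<and>
      ((\<lambda>X. \<Sum>q\<in>X. T' q w) \<longlongrightarrow> g' w) (finite_subsets_at_top UNIV)"
    using \<rho> by (smt (verit) finite_subsets_at_top_neq_bot zero_le_dist)
  have *: "x \<in> ball x0 \<rho>" using \<rho> by simp
  have eq: "g' x = dx g x y"
    using g'[OF *] by (auto simp: dx_def dest: DERIV_imp_deriv)
  show "((\<lambda>t. g t y) has_field_derivative dx g x y) (at x)"
    using g'[OF *] eq by simp
  have hs: "((\<lambda>q. T' q x) has_sum dx g x y) UNIV"
    using g'[OF *] eq by (simp add: has_sum_def)
  \<comment> \<open>the terms with \<open>i = 0\<close> vanish, so the index can be shifted\<close>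
  have inj: "inj (\<lambda>(i::nat, j::nat). (Suc i, j))"
    by (auto simp: inj_def)
  have "((\<lambda>q. T' q x) has_sum dx g x y) (range (\<lambda>(i, j). (Suc i, j)))"
  proof (rule has_sum_cong_neutral[THEN iffD1, OF _ _ _ hs])
    fix q :: "nat \<times> nat" assume "q \<in> UNIV - range (\<lambda>(i, j). (Suc i, j))"
    then have "fst q = 0"
      by (cases q; cases "fst q") (auto simp: image_iff)
    then show "T' q x = 0" by (simp add: T'_def)
  qed auto
  then have "((\<lambda>q. T' q x) \<circ> (\<lambda>(i, j). (Suc i, j)) has_sum dx g x y) UNIV"
    using has_sum_reindex[OF inj] by blast
  then show "((\<lambda>(i, j). of_nat (Suc i) * c (Suc i) j * (x - x0) ^ i * (y - y0) ^ j) has_sum dx g x y) UNIV"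
    by (rule has_sum_cong[THEN iffD1, rotated]) (auto simp: T'_def mult_ac)
qed

lemma dy_eq_dx_swap: "dy g x y = dx (\<lambda>y x. g x y) y x"
  by (simp add: dx_def dy_def)

lemma double_series_dx_series:
  assumes "double_series c x0 y0 r g"
  shows "double_series (\<lambda>i j. of_nat (Suc i) * c (Suc i) j) x0 y0 r (dx g)"
  using double_series_dx(2)[OF assms] unfolding double_series_def by blast

lemma double_series_dy_series:
  assumes "double_series c x0 y0 r g"
  shows "double_series (\<lambda>i j. of_nat (Suc j) * c i (Suc j)) x0 y0 r (dy g)"
  using double_series_swap[OF double_series_dx_series[OF double_series_swap[OF assms]]]
  by (simp add: dy_eq_dx_swap[abs_def])

lemma double_series_center_value:
  assumes "double_series c x0 y0 r g" "r > 0"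
  shows "g x0 y0 = c 0 0"
proof -
  have "((\<lambda>(i, j). c i j * (x0 - x0) ^ i * (y0 - y0) ^ j) has_sum g x0 y0) UNIV"
    using assms centre_in_ball unfolding double_series_def by blast
  moreover have "((\<lambda>(i, j). c i j * (x0 - x0) ^ i * (y0 - y0) ^ j) has_sum c 0 0) UNIV"
    by (rule has_sum_finiteI[of "{(0,0)}", THEN has_sum_cong_neutral[THEN iffD1, rotated 3]])
       (auto simp: power_0_left split: if_splits)
  ultimately show ?thesis by (rule has_sum_unique)
qed

context
  fixes g S assumes g: "analytic2_on g S"
begin

lemma analytic2_on_dx: "analytic2_on (dx g) S"
  using g double_series_dx_series unfolding analytic2_on_iff_double_series by fast

lemma analytic2_on_dy: "analytic2_on (dy g) S"
  using g double_series_dy_series unfolding analytic2_on_iff_double_series by fast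

lemma analytic2_on_isCont: "(x, y) \<in> S \<Longrightarrow> isCont (\<lambda>(x, y). g x y) (x, y)"
  using g double_series_continuous_at_center unfolding analytic2_on_iff_double_series by fast

lemma analytic2_on_has_dx:
  "(x, y) \<in> S \<Longrightarrow> ((\<lambda>t. g t y) has_field_derivative dx g x y) (at x)"
  using g double_series_dx(1)[of _ x y _ g x y] unfolding analytic2_on_iff_double_series by fastforce

lemma analytic2_on_has_dy:
  assumes "(x, y) \<in> S" shows "((\<lambda>t. g x t) has_field_derivative dy g x y) (at y)"
proof -
  obtain r c where "r > 0" and S: "double_series c x y r g"
    using g assms unfolding analytic2_on_iff_double_series by fast
  show ?thesis
    using double_series_dx(1)[OF double_series_swap[OF S], of y x] \<open>r > 0\<close>
    by (simp add: dy_eq_dx_swap)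
qed

text \<open>Both sides are the coefficient of \<open>(x - x0) (y - y0)\<close> in the expansion at the point.\<close>

lemma analytic2_on_dx_dy_commute:
  assumes "(x, y) \<in> S" shows "dy (dx g) x y = dx (dy g) x y"
proof -
  obtain r c where "r > 0" and S: "double_series c x y r g"
    using g assms unfolding analytic2_on_iff_double_series by fast
  show ?thesis
    using double_series_center_value[OF double_series_dx_series[OF double_series_dy_series[OF S]] \<open>r > 0\<close>]
      double_series_center_value[OF double_series_dy_series[OF double_series_dx_series[OF S]] \<open>r > 0\<close>]
    by simp
qed

end

definition mixed :: "(complex \<Rightarrow> complex \<Rightarrow> complex) \<Rightarrow> nat \<Rightarrow> nat \<Rightarrow> complex \<Rightarrow> complex \<Rightarrow> complex" where
  "mixed g i j = (dx ^^ i) ((dy ^^ j) g)"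

lemma analytic2_on_mixed:
  assumes "analytic2_on g S" shows "analytic2_on (mixed g i j) S"
proof -
  have "analytic2_on ((dy ^^ j) g) S"
    by (induction j) (auto simp: assms analytic2_on_dy)
  then show ?thesis
    by (induction i) (auto simp: mixed_def analytic2_on_dx)
qed

lemma dx_dy_cong_open:
  assumes "open S" "(x, y) \<in> S" and eq: "\<And>x y. (x, y) \<in> S \<Longrightarrow> g x y = h x y"
  shows "dx g x y = dx h x y" "dy g x y = dy h x y"
proof -
  have "open {t. (t, y) \<in> S}" "open {t. (x, t) \<in> S}"
    using open_vimage[OF \<open>open S\<close>, of "\<lambda>t. (t, y)"] open_vimage[OF \<open>open S\<close>, of "\<lambda>t. (x, t)"]
    by (simp_all add: vimage_def continuous_on_Pair)
  then have "\<forall>\<^sub>F t in nhds x. (t, y) \<in> S" "\<forall>\<^sub>F t in nhds y. (x, t) \<in> S"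
    using \<open>(x, y) \<in> S\<close> by (auto simp: eventually_nhds)
  then show "dx g x y = dx h x y" "dy g x y = dy h x y"
    unfolding dx_def dy_def using eq by (auto intro!: deriv_cong_ev elim: eventually_mono)
qed

lemma dy_mixed:
  assumes S: "open S" and g: "analytic2_on g S" and "(x, y) \<in> S"
  shows "dy (mixed g i j) x y = mixed g i (Suc j) x y"
  using \<open>(x, y) \<in> S\<close>
proof (induction i arbitrary: x y)
  case 0 then show ?case by (simp add: mixed_def)
next
  case (Suc i)
  have "dy (mixed g (Suc i) j) x y = dy (dx (mixed g i j)) x y"
    by (simp add: mixed_def)
  also have "\<dots> = dx (dy (mixed g i j)) x y"
    by (rule analytic2_on_dx_dy_commute[OF analytic2_on_mixed[OF g] Suc.prems])
  also have "\<dots> = dx (mixed g i (Suc j)) x y"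
    using Suc by (intro dx_dy_cong_open(1)[OF S]) auto
  finally show ?case by (simp add: mixed_def)
qed

lemma mixed_has_dx:
  assumes "analytic2_on g S" "(x, y) \<in> S"
  shows "((\<lambda>t. mixed g i j t y) has_field_derivative mixed g (Suc i) j x y) (at x)"
  using analytic2_on_has_dx[OF analytic2_on_mixed[OF assms(1)] assms(2)] by (simp add: mixed_def)

lemma mixed_has_dy:
  assumes "open S" "analytic2_on g S" "(x, y) \<in> S"
  shows "((\<lambda>t. mixed g i j x t) has_field_derivative mixed g i (Suc j) x y) (at y)"
  using analytic2_on_has_dy[OF analytic2_on_mixed[OF assms(2)] assms(3)] dy_mixed[OF assms] by simp

section \<open>Calculus of partial derivatives on the jet space\<close>

text \<open>A relation carries the existence of the derivatives along with their values, and its rules for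
  sums and products compute the derivatives of polynomial expressions by resolution.\<close>

definition has_jet_partials ::
    "jet_fun \<Rightarrow> complex \<Rightarrow> complex \<Rightarrow> complex \<Rightarrow> complex \<Rightarrow> complex \<Rightarrow> complex \<Rightarrow> bool" where
  "has_jet_partials g x y p gx gy gp \<longleftrightarrow>
     ((\<lambda>t. g t y p) has_field_derivative gx) (at x) \<and>
     ((\<lambda>t. g x t p) has_field_derivative gy) (at y) \<and>
     ((\<lambda>t. g x y t) has_field_derivative gp) (at p)"

lemma has_jet_partials_imp_pd:
  assumes "has_jet_partials g x y p gx gy gp"
  shows "pd_x g x y p = gx" "pd_y g x y p = gy" "pd_p g x y p = gp"
  using assms by (auto simp: has_jet_partials_def pd_x_def pd_y_def pd_p_def DERIV_imp_deriv)

lemma has_jet_partials_const: "has_jet_partials (\<lambda>x y p. k) x y p 0 0 0"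
  by (simp add: has_jet_partials_def)

lemma has_jet_partials_fibre: "has_jet_partials (\<lambda>x y p. p) x y p 0 0 1"
  by (simp add: has_jet_partials_def)

lemma has_jet_partials_add:
  "has_jet_partials g x y p gx gy gp \<Longrightarrow> has_jet_partials h x y p hx hy hp \<Longrightarrow>
   has_jet_partials (\<lambda>x y p. g x y p + h x y p) x y p (gx + hx) (gy + hy) (gp + hp)"
  by (auto simp: has_jet_partials_def intro!: derivative_intros)

lemma has_jet_partials_diff:
  "has_jet_partials g x y p gx gy gp \<Longrightarrow> has_jet_partials h x y p hx hy hp \<Longrightarrow>
   has_jet_partials (\<lambda>x y p. g x y p - h x y p) x y p (gx - hx) (gy - hy) (gp - hp)"
  by (auto simp: has_jet_partials_def intro!: derivative_intros)

lemma has_jet_partials_mult: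
  "has_jet_partials g x y p gx gy gp \<Longrightarrow> has_jet_partials h x y p hx hy hp \<Longrightarrow>
   has_jet_partials (\<lambda>x y p. g x y p * h x y p) x y p
     (gx * h x y p + hx * g x y p) (gy * h x y p + hy * g x y p) (gp * h x y p + hp * g x y p)"
  unfolding has_jet_partials_def by (intro conjI DERIV_mult) auto

lemma has_jet_partials_inverse:
  "has_jet_partials g x y p gx gy gp \<Longrightarrow> g x y p \<noteq> 0 \<Longrightarrow>
   has_jet_partials (\<lambda>x y p. inverse (g x y p)) x y p
     (- gx * inverse (g x y p) ^ 2) (- gy * inverse (g x y p) ^ 2) (- gp * inverse (g x y p) ^ 2)"
  by (auto simp: has_jet_partials_def power2_eq_square intro!: derivative_eq_intros)

lemma has_jet_partials_square:
  "has_jet_partials g x y p gx gy gp \<Longrightarrow>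
   has_jet_partials (\<lambda>x y p. (g x y p)\<^sup>2) x y p
     (2 * g x y p * gx) (2 * g x y p * gy) (2 * g x y p * gp)"
  by (auto simp: has_jet_partials_def intro!: derivative_eq_intros)

lemmas has_jet_partials_intros =
  has_jet_partials_const has_jet_partials_fibre has_jet_partials_add has_jet_partials_diff
  has_jet_partials_mult has_jet_partials_square

lemma has_jet_partials_eq_rhs:
  "has_jet_partials g x y p gx gy gp \<Longrightarrow> gx = gx' \<Longrightarrow> gy = gy' \<Longrightarrow> gp = gp' \<Longrightarrow>
   has_jet_partials g x y p gx' gy' gp'"
  by simp

lemma eventually_slices:
  assumes "open W" "(x, y, p) \<in> W"
  shows "\<forall>\<^sub>F t in nhds x. (t, y, p) \<in> W" "\<forall>\<^sub>F t in nhds y. (x, t, p) \<in> W"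
        "\<forall>\<^sub>F t in nhds p. (x, y, t) \<in> W"
proof -
  have "open {t. (t, y, p) \<in> W}" "open {t. (x, t, p) \<in> W}" "open {t. (x, y, t) \<in> W}"
    using open_vimage[OF \<open>open W\<close>, of "\<lambda>t. (t, y, p)"] open_vimage[OF \<open>open W\<close>, of "\<lambda>t. (x, t, p)"]
      open_vimage[OF \<open>open W\<close>, of "\<lambda>t. (x, y, t)"]
    by (simp_all add: vimage_def continuous_on_Pair)
  with assms(2) show "\<forall>\<^sub>F t in nhds x. (t, y, p) \<in> W" "\<forall>\<^sub>F t in nhds y. (x, t, p) \<in> W"
        "\<forall>\<^sub>F t in nhds p. (x, y, t) \<in> W"
    by (auto simp: eventually_nhds)
qed

lemma has_jet_partials_cong_open:
  assumes "open W" "(x, y, p) \<in> W" and eq: "\<And>x y p. (x, y, p) \<in> W \<Longrightarrow> g x y p = h x y p"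
    and h: "has_jet_partials h x y p hx hy hp"
  shows "has_jet_partials g x y p hx hy hp"
proof -
  note ev = eventually_slices[OF assms(1,2)]
  have "((\<lambda>t. g t y p) has_field_derivative hx) (at x)"
    using DERIV_cong_ev[OF refl eventually_mono[OF ev(1) eq] refl] h by (auto simp: has_jet_partials_def)
  moreover have "((\<lambda>t. g x t p) has_field_derivative hy) (at y)"
    using DERIV_cong_ev[OF refl eventually_mono[OF ev(2) eq] refl] h by (auto simp: has_jet_partials_def)
  moreover have "((\<lambda>t. g x y t) has_field_derivative hp) (at p)"
    using DERIV_cong_ev[OF refl eventually_mono[OF ev(3) eq] refl] h by (auto simp: has_jet_partials_def)
  ultimately show ?thesis by (simp add: has_jet_partials_def)
qed

text \<open>Here the partial derivatives are required to exist, which the total function \<open>deriv\<close> does not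
  express; only with that requirement is \<open>X3\<close> a derivation.\<close>

definition has_X3 ::
    "jet_fun \<Rightarrow> lifted_fun \<Rightarrow> complex \<Rightarrow> complex \<Rightarrow> complex \<Rightarrow> complex \<Rightarrow> complex \<Rightarrow> complex \<Rightarrow>
     complex \<Rightarrow> bool" where
  "has_X3 f H x y p a1 a2 a4 d \<longleftrightarrow>
     (\<exists>hx hy hp h1 h2 h4.
        ((\<lambda>t. H t y p a1 a2 a4) has_field_derivative hx) (at x) \<and>
        ((\<lambda>t. H x t p a1 a2 a4) has_field_derivative hy) (at y) \<and>
        ((\<lambda>t. H x y t a1 a2 a4) has_field_derivative hp) (at p) \<and>
        ((\<lambda>t. H x y p t a2 a4) has_field_derivative h1) (at a1) \<and>
        ((\<lambda>t. H x y p a1 t a4) has_field_derivative h2) (at a2) \<and>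
        ((\<lambda>t. H x y p a1 a2 t) has_field_derivative h4) (at a4) \<and>
        d = 1 / a4 * hx + p / a4 * hy + f x y p / a4 * hp + a2 * h1
          - pd_y f x y p * a1 / a4\<^sup>2 * h2 + (2 * a2 * a4 + pd_p f x y p * a1) / a1 * h4)"

lemma has_X3_imp_X3:
  "has_X3 f H x y p a1 a2 a4 d \<Longrightarrow> X3 f H x y p a1 a2 a4 = d"
  unfolding has_X3_def X3_def by (auto simp: DERIV_imp_deriv)

lemma has_X3_const: "has_X3 f (\<lambda>x y p a1 a2 a4. k) x y p a1 a2 a4 0"
  unfolding has_X3_def by (intro exI[of _ 0]) auto

lemma has_X3_jet:
  assumes "has_jet_partials g x y p gx gy gp"
  shows "has_X3 f (\<lambda>x y p a1 a2 a4. g x y p) x y p a1 a2 a4 ((gx + p * gy + f x y p * gp) / a4)"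
  unfolding has_X3_def using assms
  by (intro exI[of _ gx] exI[of _ gy] exI[of _ gp] exI[of _ 0])
     (auto simp: has_jet_partials_def add_divide_distrib)

lemma has_X3_inverse_a1:
  "a1 \<noteq> 0 \<Longrightarrow> has_X3 f (\<lambda>x y p a1 a2 a4. inverse a1) x y p a1 a2 a4 (- a2 * inverse a1 ^ 2)"
  unfolding has_X3_def
  by (rule exI[of _ 0], rule exI[of _ 0], rule exI[of _ 0], rule exI[of _ "- (inverse a1 ^ 2)"],
      rule exI[of _ 0], rule exI[of _ 0]) (auto intro!: derivative_eq_intros simp: power2_eq_square)

lemma has_X3_a2:
  "has_X3 f (\<lambda>x y p a1 a2 a4. a2) x y p a1 a2 a4 (- pd_y f x y p * a1 / a4\<^sup>2)"
  unfolding has_X3_def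
  by (rule exI[of _ 0], rule exI[of _ 0], rule exI[of _ 0], rule exI[of _ 0],
      rule exI[of _ 1], rule exI[of _ 0]) (auto intro!: derivative_eq_intros)

lemma has_X3_inverse_a4:
  "a4 \<noteq> 0 \<Longrightarrow> has_X3 f (\<lambda>x y p a1 a2 a4. inverse a4) x y p a1 a2 a4
     (- ((2 * a2 * a4 + pd_p f x y p * a1) / a1) * inverse a4 ^ 2)"
  unfolding has_X3_def
  by (rule exI[of _ 0], rule exI[of _ 0], rule exI[of _ 0], rule exI[of _ 0],
      rule exI[of _ 0], rule exI[of _ "- (inverse a4 ^ 2)"])
     (auto intro!: derivative_eq_intros simp: power2_eq_square)

lemma has_X3_add:
  assumes "has_X3 f G x y p a1 a2 a4 d" "has_X3 f H x y p a1 a2 a4 e"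
  shows "has_X3 f (\<lambda>x y p a1 a2 a4. G x y p a1 a2 a4 + H x y p a1 a2 a4) x y p a1 a2 a4 (d + e)"
proof -
  from assms(1) obtain gx gy gp g1 g2 g4 where g:
    "((\<lambda>t. G t y p a1 a2 a4) has_field_derivative gx) (at x)"
    "((\<lambda>t. G x t p a1 a2 a4) has_field_derivative gy) (at y)"
    "((\<lambda>t. G x y t a1 a2 a4) has_field_derivative gp) (at p)"
    "((\<lambda>t. G x y p t a2 a4) has_field_derivative g1) (at a1)"
    "((\<lambda>t. G x y p a1 t a4) has_field_derivative g2) (at a2)"
    "((\<lambda>t. G x y p a1 a2 t) has_field_derivative g4) (at a4)"
    "d = 1 / a4 * gx + p / a4 * gy + f x y p / a4 * gp + a2 * g1
          - pd_y f x y p * a1 / a4\<^sup>2 * g2 + (2 * a2 * a4 + pd_p f x y p * a1) / a1 * g4"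
    unfolding has_X3_def by blast
  from assms(2) obtain hx hy hp h1 h2 h4 where h:
    "((\<lambda>t. H t y p a1 a2 a4) has_field_derivative hx) (at x)"
    "((\<lambda>t. H x t p a1 a2 a4) has_field_derivative hy) (at y)"
    "((\<lambda>t. H x y t a1 a2 a4) has_field_derivative hp) (at p)"
    "((\<lambda>t. H x y p t a2 a4) has_field_derivative h1) (at a1)"
    "((\<lambda>t. H x y p a1 t a4) has_field_derivative h2) (at a2)"
    "((\<lambda>t. H x y p a1 a2 t) has_field_derivative h4) (at a4)"
    "e = 1 / a4 * hx + p / a4 * hy + f x y p / a4 * hp + a2 * h1
          - pd_y f x y p * a1 / a4\<^sup>2 * h2 + (2 * a2 * a4 + pd_p f x y p * a1) / a1 * h4"
    unfolding has_X3_def by blast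
  show ?thesis
    unfolding has_X3_def
    by (rule exI[of _ "gx + hx"], rule exI[of _ "gy + hy"], rule exI[of _ "gp + hp"],
        rule exI[of _ "g1 + h1"], rule exI[of _ "g2 + h2"], rule exI[of _ "g4 + h4"],
        intro conjI DERIV_add g h)
       (simp add: g(7) h(7) distrib_left)
qed

lemma has_X3_mult:
  assumes "has_X3 f G x y p a1 a2 a4 d" "has_X3 f H x y p a1 a2 a4 e"
  shows "has_X3 f (\<lambda>x y p a1 a2 a4. G x y p a1 a2 a4 * H x y p a1 a2 a4) x y p a1 a2 a4
           (d * H x y p a1 a2 a4 + e * G x y p a1 a2 a4)"
proof -
  let ?G = "G x y p a1 a2 a4" and ?H = "H x y p a1 a2 a4"
  from assms(1) obtain gx gy gp g1 g2 g4 where g: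
    "((\<lambda>t. G t y p a1 a2 a4) has_field_derivative gx) (at x)"
    "((\<lambda>t. G x t p a1 a2 a4) has_field_derivative gy) (at y)"
    "((\<lambda>t. G x y t a1 a2 a4) has_field_derivative gp) (at p)"
    "((\<lambda>t. G x y p t a2 a4) has_field_derivative g1) (at a1)"
    "((\<lambda>t. G x y p a1 t a4) has_field_derivative g2) (at a2)"
    "((\<lambda>t. G x y p a1 a2 t) has_field_derivative g4) (at a4)"
    "d = 1 / a4 * gx + p / a4 * gy + f x y p / a4 * gp + a2 * g1
          - pd_y f x y p * a1 / a4\<^sup>2 * g2 + (2 * a2 * a4 + pd_p f x y p * a1) / a1 * g4"
    unfolding has_X3_def by blast
  from assms(2) obtain hx hy hp h1 h2 h4 where h:
    "((\<lambda>t. H t y p a1 a2 a4) has_field_derivative hx) (at x)"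
    "((\<lambda>t. H x t p a1 a2 a4) has_field_derivative hy) (at y)"
    "((\<lambda>t. H x y t a1 a2 a4) has_field_derivative hp) (at p)"
    "((\<lambda>t. H x y p t a2 a4) has_field_derivative h1) (at a1)"
    "((\<lambda>t. H x y p a1 t a4) has_field_derivative h2) (at a2)"
    "((\<lambda>t. H x y p a1 a2 t) has_field_derivative h4) (at a4)"
    "e = 1 / a4 * hx + p / a4 * hy + f x y p / a4 * hp + a2 * h1
          - pd_y f x y p * a1 / a4\<^sup>2 * h2 + (2 * a2 * a4 + pd_p f x y p * a1) / a1 * h4"
    unfolding has_X3_def by blast
  show ?thesis
    unfolding has_X3_def
    by (rule exI[of _ "gx * ?H + hx * ?G"], rule exI[of _ "gy * ?H + hy * ?G"],
        rule exI[of _ "gp * ?H + hp * ?G"], rule exI[of _ "g1 * ?H + h1 * ?G"],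
        rule exI[of _ "g2 * ?H + h2 * ?G"], rule exI[of _ "g4 * ?H + h4 * ?G"],
        intro conjI DERIV_mult g h)
       (simp only: g(7) h(7), simp add: algebra_simps)
qed

lemma has_X3_power:
  assumes "has_X3 f H x y p a1 a2 a4 d"
  shows "has_X3 f (\<lambda>x y p a1 a2 a4. H x y p a1 a2 a4 ^ n) x y p a1 a2 a4
           (of_nat n * H x y p a1 a2 a4 ^ (n - 1) * d)"
proof (induction n)
  case 0 then show ?case using has_X3_const[of f 1] by simp
next
  case (Suc n)
  show ?case
    using has_X3_mult[OF assms Suc] by (cases n) (simp_all add: algebra_simps)
qed

lemma has_X3_eq_rhs: "has_X3 f H x y p a1 a2 a4 d \<Longrightarrow> d = e \<Longrightarrow> has_X3 f H x y p a1 a2 a4 e"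
  by simp

text \<open>The condition \<open>a1 \<noteq> 0\<close>, \<open>a4 \<noteq> 0\<close> is open as well, so formulas valid only there
  may be differentiated.\<close>

lemma has_X3_cong_open:
  assumes "open W" "(x, y, p) \<in> W" "a1 \<noteq> 0" "a4 \<noteq> 0"
    and eq: "\<And>x y p a1 a2 a4. (x, y, p) \<in> W \<Longrightarrow> a1 \<noteq> 0 \<Longrightarrow> a4 \<noteq> 0 \<Longrightarrow>
               G x y p a1 a2 a4 = H x y p a1 a2 a4"
    and H: "has_X3 f H x y p a1 a2 a4 d"
  shows "has_X3 f G x y p a1 a2 a4 d"
proof -
  note ev = eventually_slices[OF assms(1,2)]
  have nz: "\<forall>\<^sub>F t in nhds a1. t \<noteq> 0" "\<forall>\<^sub>F t in nhds a4. t \<noteq> 0"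
    using assms(3,4) by (auto intro: t1_space_nhds)
  have "((\<lambda>t. G t y p a1 a2 a4) has_field_derivative d) (at x) \<longleftrightarrow>
        ((\<lambda>t. H t y p a1 a2 a4) has_field_derivative d) (at x)" for d
    using ev(1) assms by (intro DERIV_cong_ev refl) (auto elim!: eventually_mono)
  moreover have "((\<lambda>t. G x t p a1 a2 a4) has_field_derivative d) (at y) \<longleftrightarrow>
        ((\<lambda>t. H x t p a1 a2 a4) has_field_derivative d) (at y)" for d
    using ev(2) assms by (intro DERIV_cong_ev refl) (auto elim!: eventually_mono)
  moreover have "((\<lambda>t. G x y t a1 a2 a4) has_field_derivative d) (at p) \<longleftrightarrow>
        ((\<lambda>t. H x y t a1 a2 a4) has_field_derivative d) (at p)" for d
    using ev(3) assms by (intro DERIV_cong_ev refl) (auto elim!: eventually_mono)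
  moreover have "((\<lambda>t. G x y p t a2 a4) has_field_derivative d) (at a1) \<longleftrightarrow>
        ((\<lambda>t. H x y p t a2 a4) has_field_derivative d) (at a1)" for d
    using nz(1) assms by (intro DERIV_cong_ev refl) (auto elim!: eventually_mono)
  moreover have "((\<lambda>t. G x y p a1 t a4) has_field_derivative d) (at a2) \<longleftrightarrow>
        ((\<lambda>t. H x y p a1 t a4) has_field_derivative d) (at a2)" for d
    using assms by (intro DERIV_cong_ev refl) auto
  moreover have "((\<lambda>t. G x y p a1 a2 t) has_field_derivative d) (at a4) \<longleftrightarrow>
        ((\<lambda>t. H x y p a1 a2 t) has_field_derivative d) (at a4)" for d
    using nz(2) assms by (intro DERIV_cong_ev refl) (auto elim!: eventually_mono)
  ultimately show ?thesis
    using H unfolding has_X3_def by simp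
qed

section \<open>Transformations onto the first Painleve equation\<close>

locale painleve1_map =
  fixes W :: "(complex \<times> complex \<times> complex) set" and f :: jet_fun
    and X :: "complex \<Rightarrow> complex" and Y :: "complex \<Rightarrow> complex \<Rightarrow> complex"
  assumes open_W: "open W" and maps: "maps_ode_on W f painleve1 X Y"
begin

lemma base_W: "(x, y, p) \<in> W \<Longrightarrow> (x, y) \<in> base W"
  by (force simp: base_def)

lemma open_base: "open (base W)"
proof -
  have "base W = (\<lambda>z. (fst z, fst (snd z))) ` W"
    by (auto simp: base_def case_prod_unfold)
  also have "\<dots> = (\<Union>p. (\<lambda>(x, y). (x, y, p)) -` W)"
    by (force simp: image_iff)
  also have "open \<dots>"
    by (intro open_UN ballI open_vimage[OF open_W]) (auto intro!: continuous_intros simp: case_prod_unfold)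
  finally show ?thesis .
qed

lemma Y_analytic: "analytic2_on Y (base W)"
  using maps by (simp add: maps_ode_on_def fiber_preserving_on_def)

definition X1 where "X1 = deriv X"
definition X2 where "X2 = deriv X1"
definition Yd where "Yd = mixed Y"
text \<open>Normalizing the derivatives of \<open>Y\<close> by \<open>Y_y\<close> makes the family closed under differentiation:
  \<open>\<partial>\<^sub>x R\<^sub>i\<^sub>j = R\<^sub>i\<^sub>+\<^sub>1\<^sub>,\<^sub>j - R\<^sub>i\<^sub>j R\<^sub>1\<^sub>1\<close> and \<open>\<partial>\<^sub>y R\<^sub>i\<^sub>j = R\<^sub>i\<^sub>,\<^sub>j\<^sub>+\<^sub>1 - R\<^sub>i\<^sub>j R\<^sub>0\<^sub>2\<close>, so in terms of
  them all later computations are polynomial.\<close>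

definition R where "R i j x y = Yd i j x y * inverse (Yd 0 1 x y)"
definition h where "h x = X2 x * inverse (X1 x)"
definition P where "P = prolong X Y"

lemma Yd_0_0: "Yd 0 0 = Y"
  by (simp add: Yd_def mixed_def)

lemma
  assumes "(x, y, p) \<in> W"
  shows X1_nz: "X1 x \<noteq> 0" and Yy_nz: "Yd 0 1 x y \<noteq> 0"
    and X_analytic: "X analytic_on {x}"
  using maps base_W[OF assms] analytic_on_subset[of X "fst ` base W" "{x}"]
  by (force simp: maps_ode_on_def fiber_preserving_on_def X1_def Yd_def mixed_def dy_def)+

lemma
  assumes "(x, y, p) \<in> W"
  shows jet_X: "has_jet_partials (\<lambda>x y p. X x) x y p (X1 x) 0 0"
    and jet_X1: "has_jet_partials (\<lambda>x y p. X1 x) x y p (X2 x) 0 0"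
    and jet_X2: "has_jet_partials (\<lambda>x y p. X2 x) x y p (deriv X2 x) 0 0"
proof -
  have "X analytic_on {x}" "X1 analytic_on {x}" "X2 analytic_on {x}"
    using X_analytic[OF assms] by (auto simp: X1_def X2_def intro!: analytic_deriv)
  then show "has_jet_partials (\<lambda>x y p. X x) x y p (X1 x) 0 0"
    "has_jet_partials (\<lambda>x y p. X1 x) x y p (X2 x) 0 0"
    "has_jet_partials (\<lambda>x y p. X2 x) x y p (deriv X2 x) 0 0"
    by (auto simp: has_jet_partials_def X1_def X2_def DERIV_deriv_iff_field_differentiable
        intro!: analytic_on_imp_differentiable_at)
qed

lemma jet_Yd:
  assumes "(x, y, p) \<in> W"
  shows "has_jet_partials (\<lambda>x y p. Yd i j x y) x y p (Yd (Suc i) j x y) (Yd i (Suc j) x y) 0"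
  unfolding has_jet_partials_def Yd_def
  using mixed_has_dx[OF Y_analytic base_W[OF assms]]
    mixed_has_dy[OF open_base Y_analytic base_W[OF assms]] by auto

lemma jet_Y:
  assumes "(x, y, p) \<in> W"
  shows "has_jet_partials (\<lambda>x y p. Y x y) x y p (Yd 1 0 x y) (Yd 0 1 x y) 0"
  using jet_Yd[OF assms, of 0 0] by (simp add: Yd_0_0)

lemma jet_inverse_Yy:
  assumes "(x, y, p) \<in> W"
  shows "has_jet_partials (\<lambda>x y p. inverse (Yd 0 1 x y)) x y p
     (- R 1 1 x y * inverse (Yd 0 1 x y)) (- R 0 2 x y * inverse (Yd 0 1 x y)) 0"
  by (rule has_jet_partials_eq_rhs[OF has_jet_partials_inverse[OF jet_Yd[OF assms] Yy_nz[OF assms]]])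
     (simp_all add: R_def power2_eq_square eval_nat_numeral)

lemma jet_R:
  assumes "(x, y, p) \<in> W"
  shows "has_jet_partials (\<lambda>x y p. R i j x y) x y p
     (R (Suc i) j x y - R i j x y * R 1 1 x y) (R i (Suc j) x y - R i j x y * R 0 2 x y) 0"
  unfolding R_def[of i j]
  by (rule has_jet_partials_eq_rhs[OF has_jet_partials_mult[OF jet_Yd[OF assms] jet_inverse_Yy[OF assms]]])
     (simp_all add: R_def algebra_simps)

lemma jet_h:
  assumes "(x, y, p) \<in> W"
  shows "has_jet_partials (\<lambda>x y p. h x) x y p (deriv X2 x * inverse (X1 x) - (h x)\<^sup>2) 0 0"
  unfolding h_def
  by (rule has_jet_partials_eq_rhs[OF has_jet_partials_mult[OF jet_X2[OF assms]
        has_jet_partials_inverse[OF jet_X1[OF assms] X1_nz[OF assms]]]])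
     (simp_all add: power2_eq_square algebra_simps)

lemma P_eq: "P x y p = (Yd 1 0 x y + p * Yd 0 1 x y) * inverse (X1 x)"
  by (simp add: P_def prolong_def X1_def Yd_def mixed_def dx_def dy_def field_simps)

text \<open>The total derivative of \<open>ln Y_y\<close>; the function \<open>f\<close> does not enter because \<open>Y_y\<close> is
  independent of \<open>p\<close>.\<close>

definition Q where "Q x y p = R 1 1 x y + p * R 0 2 x y"

lemma jet_P:
  assumes "(x, y, p) \<in> W"
  shows "has_jet_partials P x y p
     ((Yd 2 0 x y + p * Yd 1 1 x y) * inverse (X1 x) - P x y p * h x)
     (Q x y p * Yd 0 1 x y * inverse (X1 x))
     (Yd 0 1 x y * inverse (X1 x))"
proof -
  have "P = (\<lambda>x y p. (Yd 1 0 x y + p * Yd 0 1 x y) * inverse (X1 x))"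
    by (intro ext P_eq)
  moreover have "has_jet_partials \<dots> x y p
     ((Yd 2 0 x y + p * Yd 1 1 x y) * inverse (X1 x) - P x y p * h x)
     (Q x y p * Yd 0 1 x y * inverse (X1 x))
     (Yd 0 1 x y * inverse (X1 x))"
    by (rule has_jet_partials_eq_rhs,
        (rule has_jet_partials_intros jet_Yd[OF assms]
          has_jet_partials_inverse[OF jet_X1[OF assms] X1_nz[OF assms]])+)
       (use Yy_nz[OF assms] X1_nz[OF assms] in \<open>simp_all add: P_eq h_def Q_def R_def eval_nat_numeral field_simps\<close>)
  ultimately show ?thesis by simp
qed

text \<open>The second row of the structure equation says that \<open>dP - F dX\<close> is a combination of the contact
  form and of \<open>dp - f dx\<close>: its \<open>dy\<close> and \<open>dp\<close> coefficients identify \<open>a\<^sub>2 = P_y\<close> and \<open>a\<^sub>3 = P_p\<close>, and the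
  \<open>dx\<close> coefficient is then this equation.\<close>

lemma total_derivative_P:
  assumes "(x, y, p) \<in> W"
  shows "pd_x P x y p + p * pd_y P x y p + f x y p * pd_p P x y p = X1 x * painleve1 (X x) (Y x y) (P x y p)"
proof -
  obtain M a1 a2 a3 a4 where M: "M = structure_matrix a1 a2 a3 a4"
    and eq: "pullback_coframe X Y painleve1 x y p = M ** coframe f x y p"
    using maps assms unfolding maps_ode_on_def by (fastforce simp: Let_def)
  have pX: "pd_x (\<lambda>x y p. X x) x y p = X1 x" "pd_y (\<lambda>x y p. X x) x y p = 0" "pd_p (\<lambda>x y p. X x) x y p = 0"
    using has_jet_partials_imp_pd[OF jet_X[OF assms]] by auto
  have "pullback_coframe X Y painleve1 x y p $ 2 $ k = (M ** coframe f x y p) $ 2 $ k" for k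
    by (simp add: eq)
  from this[of 1] this[of 2] this[of 3]
  have "pd_x P x y p - painleve1 (X x) (Y x y) (P x y p) * X1 x = - a2 * p - a3 * f x y p"
    "pd_y P x y p = a2" "pd_p P x y p = a3"
    by (simp_all add: M pullback_coframe_def matrix_matrix_mult_def sum_3 coframe_def jacobian3_def
        structure_matrix_def pX flip: P_def)
  then show ?thesis by (simp add: algebra_simps)
qed

definition f_formula where
  "f_formula x y p = (X1 x)\<^sup>2 * (6 * (Y x y)\<^sup>2 + X x) * inverse (Yd 0 1 x y)
     - R 2 0 x y - 2 * p * R 1 1 x y - p\<^sup>2 * R 0 2 x y + (R 1 0 x y + p) * h x"

lemma f_eq:
  assumes "(x, y, p) \<in> W"
  shows "f x y p = f_formula x y p"
proof -
  have R: "Yd i j x y = R i j x y * Yd 0 1 x y" for i j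
    using Yy_nz[OF assms] by (simp add: R_def)
  \<comment> \<open>\<open>a'\<close> and \<open>b'\<close> are the inverses of \<open>a = Y_y\<close> and \<open>b = X'\<close>\<close>
  have clear: "\<phi> = b\<^sup>2 * F * a' - r20 - 2 * p * r11 - p\<^sup>2 * r02 + (r10 + p) * k"
    if "(r20 * a + p * (r11 * a)) * b' - (r10 * a + p * a) * b' * k
          + p * ((r11 + p * r02) * a * b') + \<phi> * (a * b') = b * F"
      and "a * a' = 1" "b * b' = 1" for \<phi> a a' b b' F r20 r11 r02 r10 k :: complex
    using that by algebra
  have "(R 2 0 x y * Yd 0 1 x y + p * (R 1 1 x y * Yd 0 1 x y)) * inverse (X1 x)
         - (R 1 0 x y * Yd 0 1 x y + p * Yd 0 1 x y) * inverse (X1 x) * h x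
         + p * ((R 1 1 x y + p * R 0 2 x y) * Yd 0 1 x y * inverse (X1 x))
         + f x y p * (Yd 0 1 x y * inverse (X1 x)) = X1 x * (6 * (Y x y)\<^sup>2 + X x)"
    using total_derivative_P[OF assms] has_jet_partials_imp_pd[OF jet_P[OF assms]]
    by (simp only: painleve1_def P_eq Q_def R[of 2 0] R[of 1 1] R[of 1 0])
  from clear[OF this, of "inverse (Yd 0 1 x y)"] show ?thesis
    using X1_nz[OF assms] Yy_nz[OF assms] by (simp add: f_formula_def)
qed

text \<open>Partial derivatives of \<open>Q\<close>.  The same \<open>Qxy\<close> serves as \<open>\<partial>\<^sub>y Q_x\<close> and as \<open>\<partial>\<^sub>x Q_y\<close>.\<close>

definition Qx where
  "Qx x y p = R 2 1 x y - (R 1 1 x y)\<^sup>2 + p * (R 1 2 x y - R 0 2 x y * R 1 1 x y)"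
definition Qy where
  "Qy x y p = R 1 2 x y - R 1 1 x y * R 0 2 x y + p * (R 0 3 x y - (R 0 2 x y)\<^sup>2)"
definition Qxy where
  "Qxy x y p = R 2 2 x y - R 1 2 x y * R 1 1 x y - (R 2 1 x y - (R 1 1 x y)\<^sup>2) * R 0 2 x y
     - R 1 1 x y * (R 1 2 x y - R 0 2 x y * R 1 1 x y)
     + p * (R 1 3 x y - R 0 3 x y * R 1 1 x y - 2 * R 0 2 x y * (R 1 2 x y - R 0 2 x y * R 1 1 x y))"
definition Qyy where
  "Qyy x y p = R 1 3 x y - R 1 2 x y * R 0 2 x y - (R 1 2 x y - R 1 1 x y * R 0 2 x y) * R 0 2 x y
     - R 1 1 x y * (R 0 3 x y - (R 0 2 x y)\<^sup>2)
     + p * (R 0 4 x y - R 0 3 x y * R 0 2 x y - 2 * R 0 2 x y * (R 0 3 x y - (R 0 2 x y)\<^sup>2))"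
definition Qyp where "Qyp x y = R 0 3 x y - (R 0 2 x y)\<^sup>2"

lemma jet_Q:
  assumes "(x, y, p) \<in> W"
  shows "has_jet_partials Q x y p (Qx x y p) (Qy x y p) (R 0 2 x y)"
  unfolding Q_def[abs_def]
  by (rule has_jet_partials_eq_rhs, (rule has_jet_partials_intros jet_R[OF assms])+)
     (simp_all add: Qx_def Qy_def eval_nat_numeral algebra_simps)

lemma jet_Qx:
  assumes "(x, y, p) \<in> W"
  shows "\<exists>g. has_jet_partials Qx x y p g (Qxy x y p) (R 1 2 x y - R 0 2 x y * R 1 1 x y)"
  unfolding Qx_def[abs_def]
  by (rule exI, rule has_jet_partials_eq_rhs, (rule has_jet_partials_intros jet_R[OF assms])+, rule refl)
     (simp_all add: Qxy_def eval_nat_numeral algebra_simps)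

lemma jet_Qy:
  assumes "(x, y, p) \<in> W"
  shows "has_jet_partials Qy x y p (Qxy x y p) (Qyy x y p) (Qyp x y)"
  unfolding Qy_def[abs_def]
  by (rule has_jet_partials_eq_rhs, (rule has_jet_partials_intros jet_R[OF assms])+)
     (simp_all add: Qxy_def Qyy_def Qyp_def eval_nat_numeral algebra_simps)

text \<open>\<open>fy\<close> and \<open>fp\<close> express \<open>f_y\<close> and \<open>f_p\<close> through \<open>Q\<close>.  Differentiating these forms again, instead
  of the explicit formula for \<open>f\<close>, keeps the second derivatives of \<open>f\<close> small.\<close>

definition DQ where "DQ x y p = Qx x y p + p * Qy x y p + f x y p * R 0 2 x y"
definition fy where "fy x y p = 12 * Y x y * (X1 x)\<^sup>2 - DQ x y p - (Q x y p)\<^sup>2 + Q x y p * h x"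
definition fp where "fp x y p = h x - 2 * Q x y p"

lemma jet_f:
  assumes "(x, y, p) \<in> W"
  shows "\<exists>g. has_jet_partials f x y p g (fy x y p) (fp x y p)"
proof -
  have "\<exists>g. has_jet_partials f_formula x y p g (fy x y p) (fp x y p)"
    unfolding f_formula_def[abs_def]
    by (rule exI, rule has_jet_partials_eq_rhs,
        (rule has_jet_partials_intros jet_R[OF assms] jet_X[OF assms] jet_X1[OF assms] jet_Y[OF assms]
          jet_inverse_Yy[OF assms] jet_h[OF assms])+, rule refl)
       (use Yy_nz[OF assms] in
         \<open>simp_all add: fy_def fp_def DQ_def Q_def Qx_def Qy_def f_eq[OF assms] f_formula_def
            eval_nat_numeral algebra_simps\<close>)
  then show ?thesis
    using has_jet_partials_cong_open[where g=f and h=f_formula, OF open_W assms f_eq] by blast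
qed

lemma pd_y_f: "(x, y, p) \<in> W \<Longrightarrow> pd_y f x y p = fy x y p"
  and pd_p_f: "(x, y, p) \<in> W \<Longrightarrow> pd_p f x y p = fp x y p"
  using jet_f by (blast dest: has_jet_partials_imp_pd(2), blast dest: has_jet_partials_imp_pd(3))

text \<open>Besides \<open>D (Q_y)\<close>, the derivative of \<open>D Q\<close> in the direction of \<open>y\<close> contains \<open>f_y Q_p\<close>, since \<open>D\<close>
  has the coefficient \<open>f\<close>; likewise the derivative in the direction of \<open>p\<close> contains \<open>Q_y + f_p Q_p\<close>.\<close>

lemma jet_pd_y_f:
  assumes "(x, y, p) \<in> W"
  shows "\<exists>g. has_jet_partials (pd_y f) x y p g
    (12 * Yd 0 1 x y * (X1 x)\<^sup>2 - (Qxy x y p + p * Qyy x y p + fy x y p * R 0 2 x y + f x y p * Qyp x y)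
       - 2 * Q x y p * Qy x y p + Qy x y p * h x)
    (- 2 * Qy x y p)"
proof -
  obtain g1 where g1: "has_jet_partials f x y p g1 (fy x y p) (fp x y p)"
    using jet_f[OF assms] by blast
  obtain g2 where g2: "has_jet_partials Qx x y p g2 (Qxy x y p) (R 1 2 x y - R 0 2 x y * R 1 1 x y)"
    using jet_Qx[OF assms] by blast
  have "\<exists>g. has_jet_partials fy x y p g
    (12 * Yd 0 1 x y * (X1 x)\<^sup>2 - (Qxy x y p + p * Qyy x y p + fy x y p * R 0 2 x y + f x y p * Qyp x y)
       - 2 * Q x y p * Qy x y p + Qy x y p * h x)
    (- 2 * Qy x y p)"
    unfolding fy_def[abs_def] DQ_def
    by (rule exI, rule has_jet_partials_eq_rhs,
        (rule has_jet_partials_intros g1 g2 jet_Q[OF assms] jet_Qy[OF assms] jet_R[OF assms]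
          jet_X1[OF assms] jet_Y[OF assms] jet_h[OF assms])+, rule refl)
       (simp_all add: fy_def DQ_def fp_def Q_def Qy_def Qyp_def eval_nat_numeral algebra_simps)
  then show ?thesis
    using has_jet_partials_cong_open[where g="pd_y f" and h=fy, OF open_W assms pd_y_f] by blast
qed

lemma jet_pd_p_f:
  assumes "(x, y, p) \<in> W"
  shows "\<exists>g. has_jet_partials (pd_p f) x y p g (- 2 * Qy x y p) (- 2 * R 0 2 x y)"
proof -
  have "\<exists>g. has_jet_partials fp x y p g (- 2 * Qy x y p) (- 2 * R 0 2 x y)"
    unfolding fp_def[abs_def]
    by (rule exI, rule has_jet_partials_eq_rhs,
        (rule has_jet_partials_intros jet_Q[OF assms] jet_h[OF assms])+, rule refl) simp_all
  then show ?thesis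
    using has_jet_partials_cong_open[where g="pd_p f" and h=fp, OF open_W assms pd_p_f] by blast
qed

lemma f_yp: "(x, y, p) \<in> W \<Longrightarrow> pd_p (pd_y f) x y p = - 2 * Qy x y p"
  using jet_pd_y_f by (blast dest: has_jet_partials_imp_pd(3))

lemma f_pp: "(x, y, p) \<in> W \<Longrightarrow> pd_p (pd_p f) x y p = - 2 * R 0 2 x y"
  using jet_pd_p_f by (blast dest: has_jet_partials_imp_pd(3))

lemma D_f_yp:
  assumes "(x, y, p) \<in> W"
  shows "total_D f (pd_p (pd_y f)) x y p = - 2 * (Qxy x y p + p * Qyy x y p + f x y p * Qyp x y)"
proof -
  have "has_jet_partials (\<lambda>x y p. - 2 * Qy x y p) x y p (- 2 * Qxy x y p) (- 2 * Qyy x y p) (- 2 * Qyp x y)"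
    by (rule has_jet_partials_eq_rhs, (rule has_jet_partials_intros jet_Qy[OF assms])+) simp_all
  from has_jet_partials_imp_pd[OF has_jet_partials_cong_open[where g="pd_p (pd_y f)" and h="\<lambda>x y p. - 2 * Qy x y p", OF open_W assms f_yp this]]
  show ?thesis by (simp only: total_D_def) (simp add: algebra_simps)
qed

lemma D_f_pp:
  assumes "(x, y, p) \<in> W"
  shows "total_D f (pd_p (pd_p f)) x y p = - 2 * Qy x y p"
proof -
  have "has_jet_partials (\<lambda>x y p. - 2 * R 0 2 x y) x y p
      (- 2 * (R 1 2 x y - R 0 2 x y * R 1 1 x y)) (- 2 * Qyp x y) 0"
    by (rule has_jet_partials_eq_rhs, (rule has_jet_partials_intros jet_R[OF assms])+)
       (simp_all add: Qyp_def eval_nat_numeral)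
  from has_jet_partials_imp_pd[OF has_jet_partials_cong_open[where g="pd_p (pd_p f)" and h="\<lambda>x y p. - 2 * R 0 2 x y", OF open_W assms f_pp this]]
  show ?thesis by (simp only: total_D_def Qy_def Qyp_def) (simp add: algebra_simps)
qed

text \<open>The pullbacks of \<open>1 / a\<^sub>1\<close>, \<open>1 / a\<^sub>4\<close> and \<open>a\<^sub>2 / a\<^sub>1\<close> from the target.  These three combinations,
  rather than the parameters themselves, make the action of \<open>X3\<close> polynomial.\<close>

definition u :: lifted_fun where "u x y p a1 a2 a4 = Yd 0 1 x y * inverse a1"
definition v :: lifted_fun where "v x y p a1 a2 a4 = X1 x * inverse a4"
definition w :: lifted_fun where "w x y p a1 a2 a4 = a2 * inverse a1 + (- 1) * Q x y p * inverse a4"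

text \<open>With \<open>f_p\<close> and \<open>f_y\<close> written through \<open>Q\<close>, one has \<open>f_yp = D f_pp = - 2 Q_y\<close>, so the coefficient of \<open>a\<^sub>2\<close>
  vanishes, and in the coefficient of \<open>a\<^sub>1\<close> every term containing \<open>Q\<close> cancels.  What remains is
  twice \<open>\<partial>\<^sub>y (12 Y X'\<^sup>2)\<close>.\<close>

lemma inv_I1_eq:
  assumes "(x, y, p) \<in> W" "a1 \<noteq> 0" "a4 \<noteq> 0"
  shows "inv_I1 f x y p a1 a2 a4 = 12 * u x y p a1 a2 a4 * v x y p a1 a2 a4 ^ 2"
proof -
  have fyy: "pd_y (pd_y f) x y p =
     12 * Yd 0 1 x y * (X1 x)\<^sup>2 - (Qxy x y p + p * Qyy x y p + fy x y p * R 0 2 x y + f x y p * Qyp x y)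
       - 2 * Q x y p * Qy x y p + Qy x y p * h x"
    using jet_pd_y_f[OF assms(1)] by (blast dest: has_jet_partials_imp_pd(2))
  have "2 * pd_y (pd_y f) x y p - total_D f (pd_p (pd_y f)) x y p
         - pd_p (pd_p f) x y p * pd_y f x y p + pd_p (pd_y f) x y p * pd_p f x y p
        = 24 * Yd 0 1 x y * (X1 x)\<^sup>2"
    unfolding fyy D_f_yp[OF assms(1)] f_yp[OF assms(1)] f_pp[OF assms(1)] pd_y_f[OF assms(1)] pd_p_f[OF assms(1)]
    by (simp add: fp_def algebra_simps)
  moreover have "- pd_p (pd_y f) x y p + total_D f (pd_p (pd_p f)) x y p = 0"
    by (simp add: f_yp[OF assms(1)] D_f_pp[OF assms(1)])
  ultimately show ?thesis
    using assms(2,3) unfolding inv_I1_def by (simp only:) (simp add: u_def v_def field_simps power2_eq_square)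
qed

context
  fixes x y p a1 a2 a4 :: complex assumes pt: "(x, y, p) \<in> W" "a1 \<noteq> 0" "a4 \<noteq> 0"
begin

lemma X3_X: "has_X3 f (\<lambda>x y p a1 a2 a4. X x) x y p a1 a2 a4 (v x y p a1 a2 a4)"
  using has_X3_jet[OF jet_X[OF pt(1)]] by (simp add: v_def field_simps)

lemma X3_Y: "has_X3 f (\<lambda>x y p a1 a2 a4. Y x y) x y p a1 a2 a4 (v x y p a1 a2 a4 * P x y p)"
proof -
  have "v x y p a1 a2 a4 * P x y p = (Yd 1 0 x y + p * Yd 0 1 x y + f x y p * 0) / a4"
    using X1_nz[OF pt(1)] pt(3) by (simp add: v_def P_eq field_simps)
  then show ?thesis using has_X3_jet[OF jet_Y[OF pt(1)], of f a1 a2 a4] by simp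
qed

lemma X3_P:
  "has_X3 f (\<lambda>x y p a1 a2 a4. P x y p) x y p a1 a2 a4
     (v x y p a1 a2 a4 * (6 * Y x y ^ 2 + X x))"
  using has_X3_jet[OF jet_P[OF pt(1)], of f a1 a2 a4]
    total_derivative_P[OF pt(1), unfolded has_jet_partials_imp_pd[OF jet_P[OF pt(1)]] painleve1_def]
  by (simp only:) (simp add: v_def divide_inverse mult_ac)

lemma X3_u:
  "has_X3 f u x y p a1 a2 a4 (- w x y p a1 a2 a4 * u x y p a1 a2 a4)"
proof -
  have "- w x y p a1 a2 a4 * u x y p a1 a2 a4 =
     (Yd 1 1 x y + p * Yd 0 2 x y + f x y p * 0) / a4 * inverse a1 + (- a2 * inverse a1 ^ 2) * Yd 0 1 x y"
    using pt Yy_nz[OF pt(1)] by (simp add: u_def w_def Q_def R_def field_simps power2_eq_square)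
  then show ?thesis
    unfolding u_def[abs_def]
    using has_X3_mult[OF has_X3_jet[OF jet_Yd[OF pt(1), of 0 1]] has_X3_inverse_a1[OF pt(2), of f x y p a2 a4]]
    by (simp add: eval_nat_numeral)
qed

lemma X3_v:
  "has_X3 f v x y p a1 a2 a4 (- 2 * w x y p a1 a2 a4 * v x y p a1 a2 a4)"
proof -
  have "- 2 * w x y p a1 a2 a4 * v x y p a1 a2 a4 =
     (X2 x + p * 0 + f x y p * 0) / a4 * inverse a4
      + (- ((2 * a2 * a4 + pd_p f x y p * a1) / a1) * inverse a4 ^ 2) * X1 x"
    using pt X1_nz[OF pt(1)] unfolding pd_p_f[OF pt(1)] fp_def h_def
    by (simp add: v_def w_def field_simps power2_eq_square)
  then show ?thesis
    unfolding v_def[abs_def]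
    using has_X3_mult[OF has_X3_jet[OF jet_X1[OF pt(1)]] has_X3_inverse_a4[OF pt(3), of f x y p a1 a2]]
    by simp
qed

text \<open>Substituting \<open>a\<^sub>2 / a\<^sub>1 = w + Q / a\<^sub>4\<close> leaves
  \<open>- w\<^sup>2 - (f_y + D Q + Q\<^sup>2 - Q X'' / X') / a\<^sub>4\<^sup>2\<close>, and the bracket equals \<open>12 Y X'\<^sup>2\<close>.\<close>

lemma X3_w:
  "has_X3 f w x y p a1 a2 a4
     (- 12 * Y x y * v x y p a1 a2 a4 ^ 2 + (- 1) * w x y p a1 a2 a4 ^ 2)"
proof -
  have "\<exists>d. d = - 12 * Y x y * v x y p a1 a2 a4 ^ 2 + (- 1) * w x y p a1 a2 a4 ^ 2 \<and> has_X3 f w x y p a1 a2 a4 d"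
    unfolding w_def[abs_def]
    apply (rule exI, rule conjI[rotated])
     apply (rule has_X3_add has_X3_mult has_X3_const has_X3_a2 has_X3_inverse_a1[OF pt(2)]
        has_X3_inverse_a4[OF pt(3)] has_X3_jet[OF jet_Q[OF pt(1)]])+
    using pt X1_nz[OF pt(1)] unfolding pd_y_f[OF pt(1)] pd_p_f[OF pt(1)] fy_def fp_def DQ_def
    by (simp add: v_def field_simps power2_eq_square)
  then show ?thesis by blast
qed

end

section \<open>The chain of invariants and the normalization\<close>

text \<open>The polynomials that represent \<open>I\<close> with index \<open>1;3\<close>, \<open>1;33\<close>, \<open>1;333\<close> and \<open>1;3333\<close>.\<close>

definition I1_1 :: lifted_fun where
  "I1_1 = (\<lambda>x y p a1 a2 a4. - 60 * w x y p a1 a2 a4 * u x y p a1 a2 a4 * v x y p a1 a2 a4 ^ 2)"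

definition I1_2 :: lifted_fun where
  "I1_2 = (\<lambda>x y p a1 a2 a4. 720 * Y x y * u x y p a1 a2 a4 * v x y p a1 a2 a4 ^ 4
     + 360 * w x y p a1 a2 a4 ^ 2 * u x y p a1 a2 a4 * v x y p a1 a2 a4 ^ 2)"

definition I1_3 :: lifted_fun where
  "I1_3 = (\<lambda>x y p a1 a2 a4. 720 * P x y p * u x y p a1 a2 a4 * v x y p a1 a2 a4 ^ 5
     + - 15120 * Y x y * w x y p a1 a2 a4 * u x y p a1 a2 a4 * v x y p a1 a2 a4 ^ 4
     + - 2520 * w x y p a1 a2 a4 ^ 3 * u x y p a1 a2 a4 * v x y p a1 a2 a4 ^ 2)"

definition I1_4 :: lifted_fun where
  "I1_4 = (\<lambda>x y p a1 a2 a4. 720 * (258 * Y x y ^ 2 + X x) * u x y p a1 a2 a4 * v x y p a1 a2 a4 ^ 6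
     + - 23040 * P x y p * w x y p a1 a2 a4 * u x y p a1 a2 a4 * v x y p a1 a2 a4 ^ 5
     + 241920 * Y x y * w x y p a1 a2 a4 ^ 2 * u x y p a1 a2 a4 * v x y p a1 a2 a4 ^ 4
     + 20160 * w x y p a1 a2 a4 ^ 4 * u x y p a1 a2 a4 * v x y p a1 a2 a4 ^ 2)"

lemma inv_I1_3_Suc:
  assumes pt: "(x, y, p) \<in> W" "a1 \<noteq> 0" "a4 \<noteq> 0"
    and eq: "\<And>x y p a1 a2 a4. (x, y, p) \<in> W \<Longrightarrow> a1 \<noteq> 0 \<Longrightarrow> a4 \<noteq> 0 \<Longrightarrow>
               inv_I1_3 f k x y p a1 a2 a4 = H x y p a1 a2 a4"
    and H: "has_X3 f H x y p a1 a2 a4 d"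
  shows "inv_I1_3 f (Suc k) x y p a1 a2 a4 = d"
proof -
  have "has_X3 f (inv_I1_3 f k) x y p a1 a2 a4 d"
    by (rule has_X3_cong_open[where G="inv_I1_3 f k" and H=H, OF open_W pt eq H])
  then show ?thesis
    by (simp add: inv_I1_3_def has_X3_imp_X3)
qed

context
  fixes x y p a1 a2 a4 :: complex assumes pt: "(x, y, p) \<in> W" "a1 \<noteq> 0" "a4 \<noteq> 0"
begin

lemmas X3_intros =
  X3_X[OF pt] X3_Y[OF pt] X3_P[OF pt] X3_u[OF pt] X3_v[OF pt] X3_w[OF pt]
  has_X3_const has_X3_add has_X3_power has_X3_mult

lemma I1_0_step: "has_X3 f (\<lambda>x y p a1 a2 a4. 12 * u x y p a1 a2 a4 * v x y p a1 a2 a4 ^ 2)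
    x y p a1 a2 a4 (I1_1 x y p a1 a2 a4)"
  by (rule has_X3_eq_rhs, (rule X3_intros)+)
     (simp add: I1_1_def eval_nat_numeral algebra_simps)

lemma I1_1_step: "has_X3 f I1_1 x y p a1 a2 a4 (I1_2 x y p a1 a2 a4)"
  unfolding I1_1_def
  by (rule has_X3_eq_rhs, (rule X3_intros)+)
     (simp add: I1_2_def eval_nat_numeral algebra_simps)

lemma I1_2_step: "has_X3 f I1_2 x y p a1 a2 a4 (I1_3 x y p a1 a2 a4)"
  unfolding I1_2_def
  by (rule has_X3_eq_rhs, (rule X3_intros)+)
     (simp add: I1_3_def eval_nat_numeral algebra_simps)

lemma I1_3_step: "has_X3 f I1_3 x y p a1 a2 a4 (I1_4 x y p a1 a2 a4)"
  unfolding I1_3_def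
  by (rule has_X3_eq_rhs, (rule X3_intros)+)
     (simp add: I1_4_def eval_nat_numeral algebra_simps)

text \<open>The last invariant is evaluated only after normalization, hence only where \<open>w = 0\<close>.\<close>

lemma I1_4_step:
  "w x y p a1 a2 a4 = 0 \<Longrightarrow> has_X3 f I1_4 x y p a1 a2 a4
     ((720 + 648000 * Y x y * P x y p) * u x y p a1 a2 a4 * v x y p a1 a2 a4 ^ 7)"
  unfolding I1_4_def
  by (rule has_X3_eq_rhs, (rule X3_intros)+)
     (simp add: eval_nat_numeral algebra_simps)

end

lemma inv_I1_3_eqs:
  assumes pt: "(x, y, p) \<in> W" "a1 \<noteq> 0" "a4 \<noteq> 0"
  shows "inv_I1_3 f 1 x y p a1 a2 a4 = I1_1 x y p a1 a2 a4"
    and "inv_I1_3 f 2 x y p a1 a2 a4 = I1_2 x y p a1 a2 a4"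
    and "inv_I1_3 f 3 x y p a1 a2 a4 = I1_3 x y p a1 a2 a4"
    and "inv_I1_3 f 4 x y p a1 a2 a4 = I1_4 x y p a1 a2 a4"
    and "w x y p a1 a2 a4 = 0 \<Longrightarrow> inv_I1_3 f 5 x y p a1 a2 a4 =
           (720 + 648000 * Y x y * P x y p) * u x y p a1 a2 a4 * v x y p a1 a2 a4 ^ 7"
proof -
  have 0: "inv_I1_3 f 0 x y p a1 a2 a4 = 12 * u x y p a1 a2 a4 * v x y p a1 a2 a4 ^ 2"
    if "(x, y, p) \<in> W" "a1 \<noteq> 0" "a4 \<noteq> 0" for x y p a1 a2 a4
    using inv_I1_eq[OF that] by (simp add: inv_I1_3_def)
  have 1: "inv_I1_3 f 1 x y p a1 a2 a4 = I1_1 x y p a1 a2 a4"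
    if "(x, y, p) \<in> W" "a1 \<noteq> 0" "a4 \<noteq> 0" for x y p a1 a2 a4
    using inv_I1_3_Suc[OF that 0 I1_0_step[OF that]] by simp
  have 2: "inv_I1_3 f 2 x y p a1 a2 a4 = I1_2 x y p a1 a2 a4"
    if "(x, y, p) \<in> W" "a1 \<noteq> 0" "a4 \<noteq> 0" for x y p a1 a2 a4
    using inv_I1_3_Suc[where H=I1_1, OF that 1 I1_1_step[OF that]] by (simp add: numeral_2_eq_2)
  have 3: "inv_I1_3 f 3 x y p a1 a2 a4 = I1_3 x y p a1 a2 a4"
    if "(x, y, p) \<in> W" "a1 \<noteq> 0" "a4 \<noteq> 0" for x y p a1 a2 a4
    using inv_I1_3_Suc[where H=I1_2, OF that 2 I1_2_step[OF that]] by simp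
  have 4: "inv_I1_3 f 4 x y p a1 a2 a4 = I1_4 x y p a1 a2 a4"
    if "(x, y, p) \<in> W" "a1 \<noteq> 0" "a4 \<noteq> 0" for x y p a1 a2 a4
    using inv_I1_3_Suc[where H=I1_3, OF that 3 I1_3_step[OF that]] by simp
  show "inv_I1_3 f 5 x y p a1 a2 a4 =
          (720 + 648000 * Y x y * P x y p) * u x y p a1 a2 a4 * v x y p a1 a2 a4 ^ 7"
    if "w x y p a1 a2 a4 = 0"
    using inv_I1_3_Suc[where H=I1_4, OF pt 4 I1_4_step[OF pt that]] by simp
  show "inv_I1_3 f 1 x y p a1 a2 a4 = I1_1 x y p a1 a2 a4"
    "inv_I1_3 f 2 x y p a1 a2 a4 = I1_2 x y p a1 a2 a4"
    "inv_I1_3 f 3 x y p a1 a2 a4 = I1_3 x y p a1 a2 a4"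
    "inv_I1_3 f 4 x y p a1 a2 a4 = I1_4 x y p a1 a2 a4"
    using 1[OF pt] 2[OF pt] 3[OF pt] 4[OF pt] by simp_all
qed

text \<open>On \<open>w = 0\<close> the third condition compares \<open>720 P u v\<^sup>5\<close> with \<open>720 Y u v\<^sup>4\<close>.  As a quotient with
  value \<open>1\<close> has a nonzero denominator, it forces \<open>Y \<noteq> 0\<close> and then \<open>P \<noteq> 0\<close>.\<close>

lemma normalization_iff:
  assumes W: "(x, y, p) \<in> W"
  shows "normalization f x y p (a1, a2, a4) \<longleftrightarrow>
     a1 \<noteq> 0 \<and> a4 \<noteq> 0 \<and> Y x y \<noteq> 0 \<and> P x y p \<noteq> 0 \<and> v x y p a1 a2 a4 = Y x y / P x y p \<and>
        u x y p a1 a2 a4 * v x y p a1 a2 a4 ^ 2 = - 1 \<and> w x y p a1 a2 a4 = 0"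
proof (cases "a1 \<noteq> 0 \<and> a4 \<noteq> 0")
  case True
  then have nz: "a1 \<noteq> 0" "a4 \<noteq> 0" by auto
  let ?u = "u x y p a1 a2 a4" and ?v = "v x y p a1 a2 a4" and ?w = "w x y p a1 a2 a4"
  have uv: "?u \<noteq> 0" "?v \<noteq> 0"
    using nz X1_nz[OF W] Yy_nz[OF W] by (auto simp: u_def v_def)
  have I: "inv_I1 f x y p a1 a2 a4 = - 12 \<longleftrightarrow> ?u * ?v ^ 2 = - 1"
    using inv_I1_eq[OF W nz] by (simp add: algebra_simps)
  have w: "inv_I1_3 f 1 x y p a1 a2 a4 = 0 \<longleftrightarrow> ?w = 0"
    using inv_I1_3_eqs(1)[OF W nz] uv by (simp add: I1_1_def)
  have quot: "inv_I1_3 f 3 x y p a1 a2 a4 / inv_I1_3 f 2 x y p a1 a2 a4 = 1 \<longleftrightarrow>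
      Y x y \<noteq> 0 \<and> P x y p \<noteq> 0 \<and> ?v = Y x y / P x y p" if "?w = 0"
  proof -
    have "inv_I1_3 f 3 x y p a1 a2 a4 / inv_I1_3 f 2 x y p a1 a2 a4 = P x y p * ?v / Y x y"
      using inv_I1_3_eqs(2,3)[OF W nz] uv that by (simp add: I1_2_def I1_3_def eval_nat_numeral)
    then show ?thesis using uv by (cases "P x y p = 0") (auto simp: field_simps)
  qed
  show ?thesis
    using True I w quot by (auto simp: normalization_def)
qed (auto simp: normalization_def)

lemma ex1_normalization_iff:
  assumes W: "(x, y, p) \<in> W"
  shows "(\<exists>!a. normalization f x y p a) \<longleftrightarrow> Y x y \<noteq> 0 \<and> P x y p \<noteq> 0"
proof
  assume "\<exists>!a. normalization f x y p a"
  then show "Y x y \<noteq> 0 \<and> P x y p \<noteq> 0"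
    using normalization_iff[OF W] by (metis prod_cases3)
next
  assume nz: "Y x y \<noteq> 0 \<and> P x y p \<noteq> 0"
  \<comment> \<open>the equations \<open>v = Y / P\<close>, \<open>u v\<^sup>2 = - 1\<close>, \<open>w = 0\<close> solved for the parameters\<close>
  define b4 where "b4 = X1 x * P x y p / Y x y"
  define b1 where "b1 = - Yd 0 1 x y * (Y x y / P x y p) ^ 2"
  define b2 where "b2 = b1 * Q x y p / b4"
  have "normalization f x y p (a1, a2, a4) \<longleftrightarrow> (a1, a2, a4) = (b1, b2, b4)" for a1 a2 a4
  proof
    assume "normalization f x y p (a1, a2, a4)"
    then have *: "a1 \<noteq> 0" "a4 \<noteq> 0" "v x y p a1 a2 a4 = Y x y / P x y p"
      "u x y p a1 a2 a4 * v x y p a1 a2 a4 ^ 2 = - 1" "w x y p a1 a2 a4 = 0"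
      using normalization_iff[OF W] by auto
    have "a4 = b4"
      using *(2,3) nz by (simp add: v_def b4_def field_simps)
    moreover have "a1 = b1"
      using *(1,4) nz unfolding *(3) by (simp add: u_def b1_def field_simps)
    moreover have "a2 = a1 * Q x y p / a4"
      using *(1,2,5) by (simp add: w_def field_simps)
    ultimately show "(a1, a2, a4) = (b1, b2, b4)"
      by (simp add: b2_def)
  next
    have "b1 \<noteq> 0" "b4 \<noteq> 0"
      using nz X1_nz[OF W] Yy_nz[OF W] by (auto simp: b1_def b4_def)
    moreover have "X1 x * inverse b4 = Y x y / P x y p"
      using nz X1_nz[OF W] by (simp add: b4_def field_simps)
    moreover have "Yd 0 1 x y * inverse b1 * (Y x y / P x y p)\<^sup>2 = - 1"
      using nz Yy_nz[OF W] by (simp add: b1_def field_simps)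
    moreover have "b2 * inverse b1 + - 1 * Q x y p * inverse b4 = 0"
      using \<open>b1 \<noteq> 0\<close> by (simp add: b2_def field_simps)
    moreover assume "(a1, a2, a4) = (b1, b2, b4)"
    ultimately show "normalization f x y p (a1, a2, a4)"
      using nz unfolding normalization_iff[OF W] u_def v_def w_def by simp
  qed
  then show "\<exists>!a. normalization f x y p a"
    by (intro ex1I[of _ "(b1, b2, b4)"]) auto
qed

lemma normalized_inv_eqs:
  assumes W: "(x, y, p) \<in> W" and nz: "Y x y \<noteq> 0" "P x y p \<noteq> 0"
  defines "r \<equiv> Y x y / P x y p"
  shows "normalized_inv f 2 x y p = - 720 * Y x y * r ^ 2"
    and "normalized_inv f 4 x y p = - 720 * (258 * Y x y ^ 2 + X x) * r ^ 4"
    and "normalized_inv f 5 x y p = - (720 + 648000 * Y x y * P x y p) * r ^ 5"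
proof -
  obtain a1 a2 a4 where a: "normalized_params f x y p = (a1, a2, a4)"
    by (metis prod_cases3)
  have "normalization f x y p (a1, a2, a4)"
    using theI'[of "normalization f x y p"] ex1_normalization_iff[OF W] nz
    by (simp add: a[symmetric] normalized_params_def)
  then have *: "a1 \<noteq> 0" "a4 \<noteq> 0" "v x y p a1 a2 a4 = r"
      "u x y p a1 a2 a4 * r ^ 2 = - 1" "w x y p a1 a2 a4 = 0"
    using normalization_iff[OF W] by (auto simp: r_def)
  note k = inv_I1_3_eqs[OF W *(1,2)]
  have elim_u: "c * u x y p a1 a2 a4 * r ^ (n + 2) = - c * r ^ n" for c n
  proof -
    have "c * u x y p a1 a2 a4 * r ^ (n + 2) = c * r ^ n * (u x y p a1 a2 a4 * r\<^sup>2)"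
      by (simp add: power_add power2_eq_square)
    then show ?thesis by (simp only: *(4)) simp
  qed
  show "normalized_inv f 2 x y p = - 720 * Y x y * r ^ 2"
    unfolding normalized_inv_def a prod.case k(2) I1_2_def *(3,5)
    using elim_u[of "720 * Y x y" 2] by simp
  show "normalized_inv f 4 x y p = - 720 * (258 * Y x y ^ 2 + X x) * r ^ 4"
    unfolding normalized_inv_def a prod.case k(4) I1_4_def *(3,5)
    using elim_u[of "720 * (258 * Y x y ^ 2 + X x)" 4] by simp
  show "normalized_inv f 5 x y p = - (720 + 648000 * Y x y * P x y p) * r ^ 5"
    unfolding normalized_inv_def a prod.case k(5)[OF *(5)] *(3)
    using elim_u[of "720 + 648000 * Y x y * P x y p" 5] by simp
qed

text \<open>The terms \<open>5 \<cdot> 720\<^sup>2 Y\<^sup>2 r\<^sup>4\<close> and \<open>4 \<cdot> 648000 Y P r\<^sup>5\<close> cancel because \<open>r P = Y\<close>.  This is why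
  the combination occurs in the formulas: it isolates a power of \<open>r\<close>.\<close>

lemma normalized_denominator:
  assumes W: "(x, y, p) \<in> W" and nz: "Y x y \<noteq> 0" "P x y p \<noteq> 0"
  shows "5 * (normalized_inv f 2 x y p)\<^sup>2 + 4 * normalized_inv f 5 x y p = - 2880 * (Y x y / P x y p) ^ 5"
proof -
  have "5 * (- 720 * b * r\<^sup>2)\<^sup>2 + 4 * (- (720 + 648000 * b * c) * r ^ 5) = - 2880 * r ^ 5"
    if "r * c = b" for b c r :: complex
    unfolding that[symmetric] by (simp add: eval_nat_numeral algebra_simps)
  from this[of "Y x y / P x y p" "P x y p" "Y x y"] show ?thesis
    unfolding normalized_inv_eqs[OF assms] using nz by simp
qed

lemma generic_point_iff:
  assumes W: "(x, y, p) \<in> W"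
  shows "generic_point f x y p \<longleftrightarrow> Y x y \<noteq> 0 \<and> P x y p \<noteq> 0"
proof -
  have "normalized_inv f 2 x y p \<noteq> 0 \<and>
      5 * (normalized_inv f 2 x y p)\<^sup>2 + 4 * normalized_inv f 5 x y p \<noteq> 0"
    if "Y x y \<noteq> 0" "P x y p \<noteq> 0"
    unfolding normalized_denominator[OF W that]
    unfolding normalized_inv_eqs(1)[OF W that] using that by simp
  then show ?thesis
    by (auto simp: generic_point_def ex1_normalization_iff[OF W])
qed

lemma painleve1_formulas_if_generic:
  assumes W: "(x, y, p) \<in> W" and "generic_point f x y p"
  shows "painleve1_formulas f X Y x y p"
proof -
  have nz: "Y x y \<noteq> 0" "P x y p \<noteq> 0"
    using assms generic_point_iff by auto
  note k = normalized_inv_eqs[OF W nz] normalized_denominator[OF W nz]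
  define r where "r = Y x y / P x y p"
  have r: "r \<noteq> 0" "P x y p = Y x y / r" using nz by (auto simp: r_def)
  have "c / r = 129600 * ((- 2880 * r ^ 5) / (- 720 * c * r\<^sup>2) ^ 3) * c ^ 4"
    "d = - 6 * ((120 * (- 720 * (258 * c\<^sup>2 + d) * r ^ 4) + 43 * (- 720 * c * r\<^sup>2)\<^sup>2)
            / (- 720 * c * r\<^sup>2)\<^sup>2) * c\<^sup>2"
    "c ^ 5 = - (1 / 23328000) * ((- 720 * c * r\<^sup>2) ^ 5 / (- 2880 * r ^ 5)\<^sup>2)"
    if "c \<noteq> 0" for c d :: complex
    using that r(1) by (simp_all add: field_simps eval_nat_numeral)
  from this[OF nz(1)] show ?thesis
    unfolding painleve1_formulas_def Let_def P_def[symmetric] k(4)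
    unfolding k(1,2) r_def[symmetric] unfolding r(2) by (intro conjI)
qed

lemma open_generic: "open {(x, y, p) \<in> W. generic_point f x y p}" (is "open ?G")
proof -
  have G: "?G = {z \<in> W. (\<lambda>(x, y, p). Y x y * P x y p) z \<noteq> 0}"
    using generic_point_iff by auto
  have "continuous_on W (\<lambda>(x, y, p). Y x y * P x y p)"
  proof (rule continuous_at_imp_continuous_on, safe)
    fix x y p assume W: "(x, y, p) \<in> W"
    have Yd: "isCont (\<lambda>(x, y, p). Yd i j x y) (x, y, p)" for i j
      using isCont_o2[of "(x, y, p)" "\<lambda>(x, y, p). (x, y)" "\<lambda>(x, y). Yd i j x y"]
        analytic2_on_isCont[OF analytic2_on_mixed[OF Y_analytic] base_W[OF W]]
      by (auto simp: Yd_def case_prod_unfold intro!: continuous_intros)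
    have "isCont X1 x"
      using X_analytic[OF W] by (auto simp: X1_def intro!: analytic_at_imp_isCont analytic_deriv)
    then have X1: "isCont (\<lambda>(x, y, p). X1 x) (x, y, p)"
      using isCont_o2[of "(x, y, p)" fst X1] by (simp add: case_prod_unfold)
    show "isCont (\<lambda>(x, y, p). Y x y * P x y p) (x, y, p)"
      using Yd[of 0 0] Yd[of 1 0] Yd[of 0 1] X1 X1_nz[OF W]
      by (auto simp: P_eq Yd_0_0 case_prod_unfold intro!: continuous_intros)
  qed
  from continuous_open_preimage[OF this open_W, of "- {0}"]
  have "open (W \<inter> (\<lambda>(x, y, p). Y x y * P x y p) -` (- {0}))" by auto
  also have "W \<inter> (\<lambda>(x, y, p). Y x y * P x y p) -` (- {0}) = ?G"
    unfolding G by auto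
  finally show ?thesis .
qed

text \<open>First move \<open>y\<close> to make \<open>Y\<close> nonzero, then \<open>p\<close> to make \<open>P\<close> nonzero; the second move does not
  change \<open>Y\<close>.  Each is possible because the derivative in that direction is nonzero.\<close>

lemma generic_dense: "W \<subseteq> closure {(x, y, p) \<in> W. generic_point f x y p}"
proof (clarify)
  fix x y p assume W: "(x, y, p) \<in> W"
  show "(x, y, p) \<in> closure {(x, y, p) \<in> W. generic_point f x y p}"
  proof (rule ccontr)
    define S where "S = - closure {(x, y, p) \<in> W. generic_point f x y p}"
    assume "\<not> ?thesis"
    then have "(x, y, p) \<in> S" "open S" by (auto simp: S_def)
    then have T: "open (S \<inter> W)" "(x, y, p) \<in> S \<inter> W"
      using W open_W by auto
    have "\<exists>y'. (x, y', p) \<in> S \<inter> W \<and> Y x y' \<noteq> 0"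
    proof (rule ccontr)
      assume "\<not> ?thesis"
      then have "\<forall>\<^sub>F t in nhds y. Y x t = 0"
        using eventually_slices(2)[OF T] by (auto elim!: eventually_mono)
      from deriv_cong_ev[OF this refl] show False
        using Yy_nz[OF W] by (simp add: Yd_def mixed_def dy_def)
    qed
    then obtain y' where y': "(x, y', p) \<in> S \<inter> W" "Y x y' \<noteq> 0" by blast
    have "\<exists>p'. (x, y', p') \<in> S \<inter> W \<and> P x y' p' \<noteq> 0"
    proof (rule ccontr)
      assume "\<not> ?thesis"
      then have ev: "\<forall>\<^sub>F t in nhds p. P x y' t = 0"
        using eventually_slices(3)[OF T(1) y'(1)] by (auto elim!: eventually_mono)
      have W': "(x, y', p) \<in> W" using y' by simp
      show False
        using deriv_cong_ev[OF ev refl] has_jet_partials_imp_pd(3)[OF jet_P[OF W']]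
          Yy_nz[OF W'] X1_nz[OF W'] by (simp add: pd_p_def)
    qed
    then obtain p' where "(x, y', p') \<in> S \<inter> W" "P x y' p' \<noteq> 0" by blast
    moreover from this have "generic_point f x y' p'"
      using y'(2) generic_point_iff by auto
    ultimately show False
      using closure_subset[of "{(x, y, p) \<in> W. generic_point f x y p}"] by (auto simp: S_def)
  qed
qed

end

lemma maps_ode_on_subset:
  assumes "maps_ode_on W f F X Y" "G \<subseteq> W"
  shows "maps_ode_on G f F X Y"
proof -
  have "base G \<subseteq> base W" using assms(2) unfolding base_def by (rule image_mono)
  then have "fst ` base G \<subseteq> fst ` base W" "\<And>z. z \<in> base G \<Longrightarrow> z \<in> base W" by auto
  then have "fiber_preserving_on (base G) X Y"
    using assms(1) unfolding maps_ode_on_def fiber_preserving_on_def analytic2_on_def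
    by (blast intro: analytic_on_subset)
  then show ?thesis
    using assms unfolding maps_ode_on_def by blast
qed

theorem theorem1:
  fixes f :: "complex \<Rightarrow> complex \<Rightarrow> complex \<Rightarrow> complex"
    and U :: "(complex \<times> complex \<times> complex) set"
  assumes "open U" and "analytic3_on f U"
  shows "(\<forall>W X Y. open W \<and> W \<subseteq> U \<and> maps_ode_on W f painleve1 X Y \<longrightarrow>
            (let G = {(x, y, p) \<in> W. generic_point f x y p}
             in open G \<and> W \<subseteq> closure G \<and>
                (\<forall>(x, y, p) \<in> G. painleve1_formulas f X Y x y p)))
       \<and> (equivalent_ode U f painleve1 \<longleftrightarrow>
            (\<exists>W X Y. open W \<and> W \<noteq> {} \<and> W \<subseteq> U \<and>
               (\<forall>(x, y, p) \<in> W. generic_point f x y p \<and> painleve1_formulas f X Y x y p) \<and>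
               maps_ode_on W f painleve1 X Y))"
proof -
  have generic: "open G \<and> W \<subseteq> closure G \<and> (\<forall>(x, y, p)\<in>G. painleve1_formulas f X Y x y p)"
    if "open W" "maps_ode_on W f painleve1 X Y" and G: "G = {(x, y, p) \<in> W. generic_point f x y p}"
    for W X Y G
  proof -
    interpret painleve1_map W f X Y using that by unfold_locales
    show ?thesis
      using open_generic generic_dense painleve1_formulas_if_generic by (auto simp: G)
  qed
  have "\<exists>W X Y. open W \<and> W \<noteq> {} \<and> W \<subseteq> U \<and>
               (\<forall>(x, y, p) \<in> W. generic_point f x y p \<and> painleve1_formulas f X Y x y p) \<and>
               maps_ode_on W f painleve1 X Y"
    if eqv: "equivalent_ode U f painleve1"
  proof -
    obtain W X Y where W: "open W" "W \<noteq> {}" "W \<subseteq> U" "maps_ode_on W f painleve1 X Y"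
      using eqv unfolding equivalent_ode_def by blast
    define G where "G = {(x, y, p) \<in> W. generic_point f x y p}"
    note * = generic[OF W(1,4) G_def]
    have "G \<noteq> {}" using * W(2) by auto
    moreover have "G \<subseteq> W" by (auto simp: G_def)
    moreover from this have "maps_ode_on G f painleve1 X Y"
      by (rule maps_ode_on_subset[OF W(4)])
    ultimately show ?thesis
      using * W(3) by (intro exI[of _ G] exI[of _ X] exI[of _ Y]) (auto simp: G_def)
  qed
  then have "equivalent_ode U f painleve1 \<longleftrightarrow>
      (\<exists>W X Y. open W \<and> W \<noteq> {} \<and> W \<subseteq> U \<and>
         (\<forall>(x, y, p) \<in> W. generic_point f x y p \<and> painleve1_formulas f X Y x y p) \<and>
         maps_ode_on W f painleve1 X Y)"
    unfolding equivalent_ode_def by blast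
  moreover have "\<forall>W X Y. open W \<and> W \<subseteq> U \<and> maps_ode_on W f painleve1 X Y \<longrightarrow>
            (let G = {(x, y, p) \<in> W. generic_point f x y p}
             in open G \<and> W \<subseteq> closure G \<and>
                (\<forall>(x, y, p) \<in> G. painleve1_formulas f X Y x y p))"
    unfolding Let_def using generic[OF _ _ refl] by (intro allI impI) (elim conjE)
  ultimately show ?thesis by (rule conjI[rotated])
qed

end
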